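(* Let $G$ be a connected finite simple graph and let $k\geq 3$ be an integer. Then the Hom complex $\operatorname{Hom}(G,C_k)$ is homotopy equivalent to a disjoint union of points and circles.
   Context: Graphs are finite, undirected and simple (no loops, no multiple edges). A graph homomorphism $G\to H$ is a function $V(G)\to V(H)$ preserving adjacency. For $k\ge 3$, $C_k$ is the cycle graph with $k$ vertices. For graphs $G,H$, the Hom complex $\operatorname{Hom}(G,H)$ is the following polyhedral complex (regarded as a topological space): its cells are indexed by the functions $\eta$ assigning to each $v\in V(G)$ a nonempty subset $\eta(v)\subseteq V(H)$ such that whenever $uv\in E(G)$, every element of $\eta(u)$ is adjacent in $H$ to every element of $\eta(v)$; the cell of $\eta$ is the product of simplices $\prod_{v\in V(G)}\Delta^{\eta(v)}$, viewed inside $\prod_{v\in V(G)}\Delta^{V(H)}$, where $\Delta^{S}$ denotes the simplex with vertex set $S$. Its vertices are the homomorphisms $G\to H$, and two homomorphisms are joined by an edge if and only if they differ at exactly one vertex of $G$. A disjoint union may be empty. *)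

theory Defs
  imports "HOL-Analysis.Analysis" "Graph_Theory.Graph_Theory"
begin

text \<open>
  A finite simple undirected graph is a \<open>pair_graph\<close>: a finite, loop-free, symmetric
  relation on a vertex set, so that an undirected edge is a pair of opposite arcs.
\<close>

definition cycle_graph :: "nat \<Rightarrow> nat pair_pre_digraph" where
  "cycle_graph k =
     \<lparr> pverts = {..<k},
       parcs = {(i, j). i < k \<and> j < k \<and> (j = Suc i mod k \<or> i = Suc j mod k)} \<rparr>"

lemma pair_graph_cycle_graph:
  assumes "k \<ge> 3"
  shows "pair_graph (cycle_graph k)"
proof
  show "symmetric (with_proj (cycle_graph k))"
    by (auto simp: symmetric_def cycle_graph_def sym_def)
  show "finite (parcs (cycle_graph k))"
    by (rule finite_subset[of _ "{..<k} \<times> {..<k}"]) (auto simp: cycle_graph_def)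
  have no_fix: "Suc i mod k \<noteq> i" if "i < k" for i
    using that assms by (cases "Suc i = k") auto
  show "fst e \<noteq> snd e" if "e \<in> parcs (cycle_graph k)" for e
    using that by (auto simp: cycle_graph_def dest: no_fix no_fix[symmetric])
qed (auto simp: cycle_graph_def)

text \<open>
  The geometric simplex with vertex set \<open>S\<close>, in barycentric coordinates. The coordinates
  off \<open>S\<close> are zero, so the simplex on \<open>S\<close> is a face of the simplex on any finite superset.
\<close>

definition simplex_on :: "'b set \<Rightarrow> ('b \<Rightarrow> real) set" where
  "simplex_on S = {t. (\<forall>w. 0 \<le> t w) \<and> (\<forall>w. w \<notin> S \<longrightarrow> t w = 0) \<and> sum t S = 1}"

definition hom_cells :: "'a pair_pre_digraph \<Rightarrow> 'b pair_pre_digraph \<Rightarrow> ('a \<Rightarrow> 'b set) set" where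
  "hom_cells G H =
     {\<eta> \<in> pverts G \<rightarrow>\<^sub>E {S. S \<noteq> {} \<and> S \<subseteq> pverts H}.
        \<forall>(u, v) \<in> parcs G. \<forall>x \<in> \<eta> u. \<forall>y \<in> \<eta> v. (x, y) \<in> parcs H}"

text \<open>
  For finite \<open>G\<close> and \<open>H\<close> there are finitely many cells, so the topology of the polyhedral
  complex is the subspace topology of the product of simplices, and hence of the product of
  the coordinate spaces.
\<close>

definition hom_complex ::
  "'a pair_pre_digraph \<Rightarrow> 'b pair_pre_digraph \<Rightarrow> ('a \<Rightarrow> 'b \<Rightarrow> real) topology" where
  "hom_complex G H =
     subtopology (product_topology (\<lambda>_. euclidean) (pverts G))
       (\<Union>\<eta> \<in> hom_cells G H. \<Pi>\<^sub>E v \<in> pverts G. simplex_on (\<eta> v))"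

end

theory Submission
  imports Defs
begin

text \<open>
  If \<open>k = 4\<close> or \<open>G\<close> has no arcs, the complex is a disjoint union of products of simplices. Otherwise a
  vertex can only move by \<open>\<plusminus>2\<close>, and only while its neighbours stay put. Recording the moves by real
  heights \<open>d v\<close> lifts the complex near a homomorphism \<open>f\<close> to a subset of \<open>\<real>\<^sup>V\<close> cut out by one monotone
  staircase for each arc, hence a topological lattice under pointwise minimum and maximum. Let \<open>C\<close> be the path
  component of the origin in it; its image in the complex is \<open>C\<close> modulo constant integer translations.
  If no translation preserves \<open>C\<close>, then \<open>C\<close> is bounded and \<open>x \<mapsto> min x (\<gamma> t)\<close> contracts it, for a path
  \<open>\<gamma>\<close> from its top to its bottom. Otherwise a path from \<open>0\<close> to the least period extends to an equivariant
  line, onto which the same formula deforms \<open>C\<close> equivariantly, so that the quotient is a circle.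
\<close>

section \<open>Disjoint sums and quotients\<close>

text \<open>The square is exceptional because it is the only cycle containing a 4-cycle. In every
  other one, two different vertices have at most one common neighbour, so of two adjacent vertices
  of \<open>G\<close> at most one can carry a two-element set, and the cells are cubes. Along an arc
  \<open>(u, v)\<close> with label difference 1, heights change the difference to
  \<open>1 + 2 * (d v - d u)\<close>. It has to stay 1 or -1, so integral heights satisfy
  \<open>d u - d v = 0\<close> or \<open>d u - d v = 1\<close>; this is the origin of the
  inequalities between floors and ceilings that define the staircase. The homotopies are written
  down on compact sets of heights and descend to the complex, because a continuous surjection from a
  compact space onto a Hausdorff space is a quotient map. What remains to be checked is constancy on
  fibres, that is, compatibility with the translations by those \<open>m\<close> for which
  \<open>k\<close> divides \<open>2 * m\<close>.\<close>

lemma continuous_map_prod_sum_topology: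
  assumes "\<And>i. i \<in> I \<Longrightarrow> continuous_map (prod_topology T (X i)) Z (\<lambda>(t, x). h (t, i, x))"
  shows "continuous_map (prod_topology T (sum_topology X I)) Z h"
  unfolding continuous_map_def
proof (intro conjI allI impI)
  show "h \<in> topspace (prod_topology T (sum_topology X I)) \<rightarrow> topspace Z"
    using assms by (fastforce simp: continuous_map_def Pi_iff)
  fix U assume U: "openin Z U"
  show "openin (prod_topology T (sum_topology X I))
          {x \<in> topspace (prod_topology T (sum_topology X I)). h x \<in> U}" (is "openin _ ?S")
    unfolding openin_prod_topology_alt
  proof clarify
    fix t i x assume tix: "(t, i, x) \<in> topspace (prod_topology T (sum_topology X I))" "h (t, i, x) \<in> U"
    then have i: "i \<in> I" and t: "t \<in> topspace T" and x: "x \<in> topspace (X i)" by auto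
    let ?R = "{p \<in> topspace (prod_topology T (X i)). (\<lambda>(t, x). h (t, i, x)) p \<in> U}"
    have "openin (prod_topology T (X i)) ?R"
      using assms[OF i] U by (auto simp: continuous_map_def)
    moreover have "(t, x) \<in> ?R" using t x tix(2) by auto
    ultimately obtain V W where VW: "openin T V" "openin (X i) W" "t \<in> V" "x \<in> W" "V \<times> W \<subseteq> ?R"
      unfolding openin_prod_topology_alt by meson
    \<comment> \<open>Each summand sits openly in the sum, so a box found over one summand is a
      neighbourhood in the whole product.\<close>
    have "openin (sum_topology X I) (Pair i ` W)"
      using open_map_component_injection[OF i] VW(2) by (auto simp: open_map_def)
    moreover have "V \<times> (Pair i ` W) \<subseteq> ?S"
      using VW(5) i by auto
    ultimately show "\<exists>U V. openin T U \<and> openin (sum_topology X I) V \<and> t \<in> U \<and> (i, x) \<in> V \<and> U \<times> V \<subseteq> ?S"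
      using VW by blast
  qed
qed

lemma continuous_map_from_sum_topology:
  assumes "\<And>i. i \<in> I \<Longrightarrow> continuous_map (X i) Z (\<lambda>x. h (i, x))"
  shows "continuous_map (sum_topology X I) Z h"
  unfolding continuous_map_def
proof (intro conjI allI impI)
  show "h \<in> topspace (sum_topology X I) \<rightarrow> topspace Z"
    using assms by (fastforce simp: continuous_map_def Pi_iff)
  fix U assume U: "openin Z U"
  show "openin (sum_topology X I) {x \<in> topspace (sum_topology X I). h x \<in> U}"
    unfolding openin_sum_topology
  proof (intro conjI ballI)
    fix i assume i: "i \<in> I"
    have "openin (X i) {x \<in> topspace (X i). h (i, x) \<in> U}"
      using assms[OF i] U by (auto simp: continuous_map_def)
    also have "{x \<in> topspace (X i). h (i, x) \<in> U} = {x. (i, x) \<in> {x \<in> topspace (sum_topology X I). h x \<in> U}}"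
      using i by auto
    finally show "openin (X i) \<dots>" .
  qed auto
qed

lemma homotopic_with_sum_topology:
  assumes "\<And>i. i \<in> I \<Longrightarrow> homotopic_with (\<lambda>_. True) (X i) (Y i) (f i) (g i)"
  shows "homotopic_with (\<lambda>_. True) (sum_topology X I) (sum_topology Y I)
           (\<lambda>(i, x). (i, f i x)) (\<lambda>(i, x). (i, g i x))"
proof -
  have "\<forall>i. \<exists>h. i \<in> I \<longrightarrow> continuous_map (prod_topology (top_of_set {0..1::real}) (X i)) (Y i) h \<and>
          (\<forall>x. h (0, x) = f i x) \<and> (\<forall>x. h (1, x) = g i x)"
    using assms unfolding homotopic_with_def by meson
  then obtain h where h: "\<And>i. i \<in> I \<Longrightarrow> continuous_map (prod_topology (top_of_set {0..1::real}) (X i)) (Y i) (h i)"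
      "\<And>i x. i \<in> I \<Longrightarrow> h i (0, x) = f i x" "\<And>i x. i \<in> I \<Longrightarrow> h i (1, x) = g i x"
    by metis
  have "continuous_map (prod_topology (top_of_set {0..1::real}) (sum_topology X I)) (sum_topology Y I)
          (\<lambda>(t, i, x). (i, h i (t, x)))"
  proof (rule continuous_map_prod_sum_topology)
    fix i assume i: "i \<in> I"
    have "continuous_map (prod_topology (top_of_set {0..1::real}) (X i)) (sum_topology Y I) (Pair i \<circ> h i)"
      using h(1)[OF i] continuous_map_component_injection[OF i] by (rule continuous_map_compose)
    then show "continuous_map (prod_topology (top_of_set {0..1}) (X i)) (sum_topology Y I)
         (\<lambda>(t, x). case (t, i, x) of (t, i, x) \<Rightarrow> (i, h i (t, x)))"
      by (simp add: comp_def case_prod_unfold)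
  qed
  then show ?thesis
    by (subst homotopic_with) (force simp: h)+
qed

lemma homotopy_equivalent_space_sum_topology:
  assumes "\<And>i. i \<in> I \<Longrightarrow> X i homotopy_equivalent_space Y i"
  shows "sum_topology X I homotopy_equivalent_space sum_topology Y I"
proof -
  have "\<forall>i. \<exists>f g. i \<in> I \<longrightarrow> continuous_map (X i) (Y i) f \<and> continuous_map (Y i) (X i) g \<and>
          homotopic_with (\<lambda>x. True) (X i) (X i) (g \<circ> f) id \<and> homotopic_with (\<lambda>x. True) (Y i) (Y i) (f \<circ> g) id"
    using assms unfolding homotopy_equivalent_space_def by meson
  then obtain f g where fg:
      "\<And>i. i \<in> I \<Longrightarrow> continuous_map (X i) (Y i) (f i)" "\<And>i. i \<in> I \<Longrightarrow> continuous_map (Y i) (X i) (g i)"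
      "\<And>i. i \<in> I \<Longrightarrow> homotopic_with (\<lambda>x. True) (X i) (X i) (g i \<circ> f i) id"
      "\<And>i. i \<in> I \<Longrightarrow> homotopic_with (\<lambda>x. True) (Y i) (Y i) (f i \<circ> g i) id"
    by metis
  have cont: "continuous_map (sum_topology X' I) (sum_topology Y' I) (\<lambda>(i, x). (i, f' i x))"
    if "\<And>i. i \<in> I \<Longrightarrow> continuous_map (X' i) (Y' i) (f' i)"
    for X' :: "_ \<Rightarrow> 'x topology" and Y' :: "_ \<Rightarrow> 'y topology" and f'
  proof (rule continuous_map_from_sum_topology)
    fix i assume i: "i \<in> I"
    show "continuous_map (X' i) (sum_topology Y' I) (\<lambda>x. case (i, x) of (i, x) \<Rightarrow> (i, f' i x))"
      using continuous_map_compose[of "X' i" "Y' i" "f' i" "sum_topology Y' I" "Pair i",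
          OF that[OF i] continuous_map_component_injection[OF i]]
      unfolding comp_def case_prod_conv .
  qed
  have id_eq: "(\<lambda>(i, x). (i, id x)) = id" by auto
  have "homotopic_with (\<lambda>x. True) (sum_topology X I) (sum_topology X I)
          ((\<lambda>(i, x). (i, g i x)) \<circ> (\<lambda>(i, x). (i, f i x))) id"
    using homotopic_with_sum_topology[of I X X "\<lambda>i. g i \<circ> f i" "\<lambda>_. id"] fg(3)
    by (simp add: comp_def case_prod_unfold id_eq id_def)
  moreover have "homotopic_with (\<lambda>x. True) (sum_topology Y I) (sum_topology Y I)
          ((\<lambda>(i, x). (i, f i x)) \<circ> (\<lambda>(i, x). (i, g i x))) id"
    using homotopic_with_sum_topology[of I Y Y "\<lambda>i. f i \<circ> g i" "\<lambda>_. id"] fg(4)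
    by (simp add: comp_def case_prod_unfold id_eq id_def)
  ultimately show ?thesis
    unfolding homotopy_equivalent_space_def using cont[of X Y f, OF fg(1)] cont[of Y X g, OF fg(2)]
    by (intro exI conjI)
qed

text \<open>Finiteness makes \<open>snd\<close> a closed map: the image of a closed set is a finite
  union of sets closed in \<open>X\<close>. Disjointness makes it injective.\<close>

lemma homeomorphic_space_sum_topology_partition:
  assumes "finite I" "\<And>i. i \<in> I \<Longrightarrow> closedin X (A i)" "topspace X = (\<Union>i\<in>I. A i)" "disjoint_family_on A I"
  shows "sum_topology (\<lambda>i. subtopology X (A i)) I homeomorphic_space X"
proof -
  have sub: "A i \<subseteq> topspace X" if "i \<in> I" for i using that assms(3) by auto
  have cont: "continuous_map (sum_topology (\<lambda>i. subtopology X (A i)) I) X snd"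
    by (rule continuous_map_from_sum_topology) (auto intro: continuous_map_from_subtopology)
  have closed: "closed_map (sum_topology (\<lambda>i. subtopology X (A i)) I) X snd"
    unfolding closed_map_def forall_closedin_sum_topology
  proof (intro allI impI)
    fix T assume T: "\<forall>i\<in>I. closedin (subtopology X (A i)) (T i)"
    have "closedin X (T i)" if "i \<in> I" for i
      using T assms(2) that closedin_trans_full by blast
    then have "closedin X (\<Union>i\<in>I. T i)" using closedin_Union[of "T ` I" X] assms(1) by fastforce
    then show "closedin X (snd ` Sigma I T)" by (simp add: snd_image_Sigma)
  qed
  have inj: "inj_on snd (topspace (sum_topology (\<lambda>i. subtopology X (A i)) I))"
    using assms(4) by (auto simp: inj_on_def disjoint_family_on_def)
  have "snd ` topspace (sum_topology (\<lambda>i. subtopology X (A i)) I) = topspace X"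
    using sub assms(3) by (auto simp: snd_image_Sigma)
  then show ?thesis
    using bijective_closed_imp_homeomorphic_map[OF cont closed _ inj]
    by (auto simp: homeomorphic_map_imp_homeomorphic_space)
qed

lemma homotopy_equivalent_points_circles:
  fixes \<A> :: "'x set set"
  assumes "finite \<A>" "\<And>A. A \<in> \<A> \<Longrightarrow> closedin X A" "topspace X = \<Union>\<A>" "disjoint \<A>"
    and "\<And>A. A \<in> \<A> \<Longrightarrow> \<exists>Y\<in>{top_of_set {0::complex}, top_of_set (sphere 0 1)}.
            subtopology X A homotopy_equivalent_space Y"
  shows "\<exists>(I :: nat set) (Y :: nat \<Rightarrow> complex topology).
           (\<forall>i \<in> I. Y i = top_of_set {0} \<or> Y i = top_of_set (sphere 0 1)) \<and>
           X homotopy_equivalent_space sum_topology Y I"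
proof -
  obtain A where A: "bij_betw A {..<card \<A>} \<A>"
    using ex_bij_betw_nat_finite[OF assms(1)] by (auto simp: lessThan_atLeast0)
  let ?I = "{..<card \<A>}"
  have mem: "A i \<in> \<A>" if "i \<in> ?I" for i using A that by (auto simp: bij_betw_def)
  have "\<forall>i\<in>?I. \<exists>Y. (Y = top_of_set {0::complex} \<or> Y = top_of_set (sphere 0 1)) \<and>
            subtopology X (A i) homotopy_equivalent_space Y"
    using assms(5)[OF mem] by blast
  then obtain Y where Y: "\<And>i. i \<in> ?I \<Longrightarrow> Y i = top_of_set {0::complex} \<or> Y i = top_of_set (sphere 0 1)"
     "\<And>i. i \<in> ?I \<Longrightarrow> subtopology X (A i) homotopy_equivalent_space Y i" by metis
  have "disjoint_family_on A ?I"
    unfolding disjoint_family_on_def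
    using assms(4) mem A by (metis bij_betw_def inj_on_def disjointD)
  moreover have "topspace X = (\<Union>i\<in>?I. A i)"
    using A assms(3) by (metis bij_betw_imp_surj_on)
  ultimately have "sum_topology (\<lambda>i. subtopology X (A i)) ?I homeomorphic_space X"
    using homeomorphic_space_sum_topology_partition[of ?I X A] assms(2)[OF mem] by blast
  then have "X homotopy_equivalent_space sum_topology (\<lambda>i. subtopology X (A i)) ?I"
    using homeomorphic_imp_homotopy_equivalent_space homotopy_equivalent_space_sym by blast
  also have "sum_topology (\<lambda>i. subtopology X (A i)) ?I homotopy_equivalent_space sum_topology Y ?I"
    using Y(2) by (rule homotopy_equivalent_space_sum_topology)
  finally show ?thesis using Y(1) by blast
qed

text \<open>A quotient map times an identity need not be a quotient map. Compactness and the
  Hausdorff property give it directly for the interval times \<open>p\<close>, so a homotopy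
  upstairs that is constant on the fibres descends.\<close>

lemma homotopic_with_quotient:
  assumes "compact_space M" "Hausdorff_space A"
    and p: "continuous_map M A p" "p ` topspace M = topspace A"
    and F: "continuous_map (prod_topology (top_of_set {0..1::real}) M) Y F"
    and fib: "\<And>s x y. \<lbrakk>s \<in> {0..1}; x \<in> topspace M; y \<in> topspace M; p x = p y\<rbrakk> \<Longrightarrow> F (s, x) = F (s, y)"
    and "\<And>x. x \<in> topspace M \<Longrightarrow> F (0, x) = f (p x)" "\<And>x. x \<in> topspace M \<Longrightarrow> F (1, x) = g (p x)"
  shows "homotopic_with (\<lambda>_. True) A Y f g"
proof -
  let ?I = "top_of_set {0..1::real}"
  have cpt: "compact_space (prod_topology ?I M)"
    using assms(1) by (simp add: compact_space_prod_topology compact_space_subtopology)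
  have "Hausdorff_space (prod_topology ?I A)"
    using assms(2) by (simp add: Hausdorff_space_prod_topology Hausdorff_space_subtopology)
  moreover have "continuous_map (prod_topology ?I M) (prod_topology ?I A) (\<lambda>(s, x). (s, p x))"
    using p(1) by (intro continuous_map_prod_top[THEN iffD2]) auto
  moreover have "(\<lambda>(s, x). (s, p x)) ` topspace (prod_topology ?I M) = topspace (prod_topology ?I A)"
    using p(2) by (force simp: image_iff)
  ultimately have "quotient_map (prod_topology ?I M) (prod_topology ?I A) (\<lambda>(s, x). (s, p x))"
    using cpt by (intro continuous_imp_quotient_map)
  then obtain h where h: "continuous_map (prod_topology ?I A) Y h"
      "\<And>z. z \<in> topspace (prod_topology ?I M) \<Longrightarrow> h ((\<lambda>(s, x). (s, p x)) z) = F z"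
    using F by (rule quotient_map_lift_exists) (auto intro: fib)
  have "h (s, p x) = F (s, x)" if "s \<in> {0..1}" "x \<in> topspace M" for s x
    using h(2)[of "(s, x)"] that by simp
  then have "\<forall>y \<in> topspace A. h (0, y) = f y \<and> h (1, y) = g y"
    using assms(7,8) p(2)[symmetric] by auto
  then show ?thesis
    using h(1) by (subst homotopic_with) auto
qed

section \<open>Gluing at the integers, path components, the circle\<close>

lemma continuous_floor_glue:
  fixes g :: "int \<Rightarrow> real \<Rightarrow> 'b::topological_space"
  assumes "\<And>n. continuous_on UNIV (g n)" "\<And>n. g n (of_int n + 1) = g (n + 1) (of_int n + 1)"
  shows "continuous_on UNIV (\<lambda>t. g \<lfloor>t\<rfloor> t)"
proof (rule continuous_at_imp_continuous_on, intro ballI)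
  fix t :: real
  have tends: "(g n \<longlongrightarrow> g n t) (at t within S)" for n S
    using assms(1)[of n] by (meson UNIV_I continuous_on_def tendsto_within_subset top_greatest)
  have "\<lfloor>s\<rfloor> = \<lfloor>t\<rfloor>" if "t < s" "s < of_int \<lfloor>t\<rfloor> + 1" for s
    using that by (intro floor_unique) linarith+
  moreover have "\<forall>\<^sub>F s in at_right t. s \<in> {t<..<of_int \<lfloor>t\<rfloor> + 1}"
    by (rule eventually_at_right_real) linarith
  ultimately have "\<forall>\<^sub>F s in at_right t. g \<lfloor>t\<rfloor> s = g \<lfloor>s\<rfloor> s"
    by (simp add: eventually_mono)
  then have R: "((\<lambda>t. g \<lfloor>t\<rfloor> t) \<longlongrightarrow> g \<lfloor>t\<rfloor> t) (at_right t)"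
    using tends by (rule tendsto_cong[THEN iffD1])
  have "\<lfloor>s\<rfloor> = \<lceil>t\<rceil> - 1" if "of_int \<lceil>t\<rceil> - 1 < s" "s < t" for s
    using that by (intro floor_unique) (simp, linarith)
  moreover have "\<forall>\<^sub>F s in at_left t. s \<in> {of_int \<lceil>t\<rceil> - 1<..<t}"
    by (rule eventually_at_left_real) linarith
  ultimately have eq: "\<forall>\<^sub>F s in at_left t. g (\<lceil>t\<rceil> - 1) s = g \<lfloor>s\<rfloor> s"
    by (simp add: eventually_mono)
  \<comment> \<open>The left-hand limit uses the index \<open>\<lceil>t\<rceil> - 1\<close>, which
    equals \<open>\<lfloor>t\<rfloor>\<close> unless \<open>t\<close> is an integer; there the
    second hypothesis makes the two values agree.\<close>
  have "g (\<lceil>t\<rceil> - 1) t = g \<lfloor>t\<rfloor> t"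
  proof (cases "t \<in> \<int>")
    case True
    then obtain m where "t = of_int m" by (auto elim: Ints_cases)
    then show ?thesis using assms(2)[of "m - 1"] by simp
  next
    case False
    then have "\<lceil>t\<rceil> = \<lfloor>t\<rfloor> + 1" by (metis Ints_of_int ceiling_altdef)
    then show ?thesis by simp
  qed
  then have "(g (\<lceil>t\<rceil> - 1) \<longlongrightarrow> g \<lfloor>t\<rfloor> t) (at_left t)"
    using tends[of "\<lceil>t\<rceil> - 1"] by metis
  with eq have L: "((\<lambda>t. g \<lfloor>t\<rfloor> t) \<longlongrightarrow> g \<lfloor>t\<rfloor> t) (at_left t)"
    by (rule tendsto_cong[THEN iffD1])
  show "isCont (\<lambda>t. g \<lfloor>t\<rfloor> t) t"
    unfolding isCont_def filterlim_at_split using L R by blast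
qed

text \<open>Two paths are combined pointwise by \<open>F\<close>. Applied to minimum and maximum,
  this carries lattice operations over to path components.\<close>

lemma path_component_map2:
  assumes "path_component S x y" "path_component S x' y'"
    and "continuous_on UNIV (\<lambda>(a, b). F a b)" "\<And>a b. a \<in> S \<Longrightarrow> b \<in> S \<Longrightarrow> F a b \<in> T"
  shows "path_component T (F x x') (F y y')"
proof -
  obtain g h where g: "path g" "path_image g \<subseteq> S" "pathstart g = x" "pathfinish g = y"
    and h: "path h" "path_image h \<subseteq> S" "pathstart h = x'" "pathfinish h = y'"
    using assms(1,2) unfolding path_component_def by blast
  have "continuous_on {0..1} ((\<lambda>(a, b). F a b) \<circ> (\<lambda>t. (g t, h t)))"
    using g(1) h(1) assms(3) unfolding path_def
    by (intro continuous_on_compose continuous_on_Pair) (auto intro: continuous_on_subset)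
  then have "path (\<lambda>t. F (g t) (h t))" by (simp add: path_def comp_def)
  then show ?thesis
    unfolding path_component_def using g h assms(4)
    by (intro exI[of _ "\<lambda>t. F (g t) (h t)"])
       (auto simp: path_image_def pathstart_def pathfinish_def)
qed

lemma path_component_map:
  fixes x y :: "'a::topological_space"
  assumes "path_component S x y" "continuous_on UNIV F" "\<And>a. a \<in> S \<Longrightarrow> F a \<in> T"
  shows "path_component T (F x) (F y)"
proof -
  have "continuous_on UNIV (\<lambda>p::'a \<times> 'a. F (fst p))"
    by (rule continuous_on_compose2[OF assms(2)]) (auto intro: continuous_intros)
  then show ?thesis
    using path_component_map2[OF assms(1,1), where F = "\<lambda>a _. F a"] assms(3)
    by (simp add: case_prod_unfold)
qed

lemma path_component_segment:
  fixes x y :: "'i \<Rightarrow> real"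
  assumes "\<And>t. t \<in> {0..1} \<Longrightarrow> (\<lambda>i. (1 - t) * x i + t * y i) \<in> S"
  shows "path_component S x y"
  unfolding path_component_def
  using assms
  by (intro exI[of _ "\<lambda>t i. (1 - t) * x i + t * y i"])
     (auto simp: path_def path_image_def pathstart_def pathfinish_def
           intro!: continuous_on_coordinatewise_then_product continuous_intros)

text \<open>The empty space counts as contractible too, hence the second hypothesis.\<close>

lemma contractible_homotopy_equivalent_point:
  assumes "contractible_space X" "topspace X \<noteq> {}"
  shows "X homotopy_equivalent_space top_of_set {b :: 'b::topological_space}"
proof -
  obtain a where a: "homotopic_with (\<lambda>x. True) X X id (\<lambda>x. a)"
    using assms(1) unfolding contractible_space_def by blast
  then have "continuous_map X X (\<lambda>x. a)"
    using homotopic_with_imp_continuous_maps by blast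
  then have aX: "a \<in> topspace X" using assms(2) by (auto simp: continuous_map_def)
  have "homotopic_with (\<lambda>x. True) X X ((\<lambda>_::'b. a) \<circ> (\<lambda>_. b)) id"
    using a by (simp add: o_def homotopic_with_sym)
  moreover have "homotopic_with (\<lambda>x. True) (top_of_set {b}) (top_of_set {b}) ((\<lambda>_. b) \<circ> (\<lambda>_::'b. a)) id"
    by (rule homotopic_with_equal) auto
  ultimately show ?thesis
    unfolding homotopy_equivalent_space_def using aX
    by (intro exI[of _ "\<lambda>_. b"] exI[of _ "\<lambda>_. a"]) auto
qed

lemma continuous_map_quotient:
  assumes "compact_space M" "Hausdorff_space A" "continuous_map M A p" "p ` topspace M = topspace A"
    and "continuous_map M Y F"
    and "\<And>x y. \<lbrakk>x \<in> topspace M; y \<in> topspace M; p x = p y\<rbrakk> \<Longrightarrow> F x = F y"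
  obtains g where "continuous_map A Y g" "\<And>x. x \<in> topspace M \<Longrightarrow> g (p x) = F x"
proof (rule quotient_map_lift_exists[OF continuous_imp_quotient_map[OF assms(3,1,2,4)] assms(5)])
  fix g assume "continuous_map A Y g" "\<And>x. x \<in> topspace M \<Longrightarrow> g (p x) = F x"
  then show thesis by (rule that)
qed (rule assms(6))

lemma cis_2pi_eq_iff: "cis (2 * pi * s) = cis (2 * pi * t) \<longleftrightarrow> (\<exists>j::int. t = s + of_int j)"
proof
  assume "cis (2 * pi * s) = cis (2 * pi * t)"
  then have "sin (2 * pi * t) = sin (2 * pi * s) \<and> cos (2 * pi * t) = cos (2 * pi * s)"
    by (simp add: complex_eq_iff)
  then obtain n :: int where "2 * pi * t = 2 * pi * s + 2 * pi * of_int n"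
    using sin_cos_eq_iff by blast
  then have "2 * pi * (t - (s + of_int n)) = 0" by (simp add: algebra_simps)
  then show "\<exists>j::int. t = s + of_int j" by auto
next
  assume "\<exists>j::int. t = s + of_int j"
  then obtain j :: int where "t = s + of_int j" by blast
  then have "2 * pi * t = 2 * pi * s + 2 * pi * of_int j" by (simp add: algebra_simps)
  then have "sin (2 * pi * t) = sin (2 * pi * s) \<and> cos (2 * pi * t) = cos (2 * pi * s)"
    using sin_cos_eq_iff by blast
  then show "cis (2 * pi * s) = cis (2 * pi * t)" by (simp add: complex_eq_iff)
qed

lemma cis_2pi_image: "(\<lambda>t. cis (2 * pi * t)) ` {0..1} = sphere 0 1"
proof
  show "sphere 0 1 \<subseteq> (\<lambda>t. cis (2 * pi * t)) ` {0..1}"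
  proof
    fix z :: complex assume "z \<in> sphere 0 1"
    then have "z = cis (Arg2pi z)"
      using Arg2pi_eq[of z] by (simp add: cis_conv_exp)
    then show "z \<in> (\<lambda>t. cis (2 * pi * t)) ` {0..1}"
      using Arg2pi[of z] by (intro image_eqI[of _ _ "Arg2pi z / (2 * pi)"]) auto
  qed
qed auto

section \<open>Simplices and cells\<close>

lemma closed_simplex_on: "finite S \<Longrightarrow> closed (simplex_on S)"
proof -
  have "simplex_on S = (\<Inter>w. {t. 0 \<le> t w}) \<inter> (\<Inter>w\<in>- S. {t. t w = 0}) \<inter> {t. sum t S = 1}"
    by (auto simp: simplex_on_def)
  then show ?thesis
    by (simp only:) (intro closed_Int closed_INT ballI closed_Collect_le closed_Collect_eq
        continuous_on_sum continuous_on_const continuous_on_product_coordinates)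
qed

lemma simplex_on_mono: "S \<subseteq> T \<Longrightarrow> finite T \<Longrightarrow> simplex_on S \<subseteq> simplex_on T"
  unfolding simplex_on_def by (auto simp: sum.mono_neutral_left[of T S, symmetric])

lemma simplex_on_disjoint: "S \<inter> T = {} \<Longrightarrow> simplex_on S \<inter> simplex_on T = {}"
proof (rule ccontr)
  assume "S \<inter> T = {}" "simplex_on S \<inter> simplex_on T \<noteq> {}"
  then obtain t where t: "t \<in> simplex_on S" "t \<in> simplex_on T" by blast
  have "sum t S = 0"
    using t(2) \<open>S \<inter> T = {}\<close> by (intro sum.neutral) (auto simp: simplex_on_def)
  then show False using t(1) by (simp add: simplex_on_def)
qed

lemma simplex_on_nonempty:
  assumes "finite S" "S \<noteq> {}"
  shows "simplex_on S \<noteq> {}"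
proof -
  obtain a where "a \<in> S" using assms by blast
  then have "(\<lambda>w. of_bool (w = a)) \<in> simplex_on S"
    using assms(1) by (auto simp: simplex_on_def)
  then show ?thesis by blast
qed

lemma contractible_simplex_on:
  assumes "finite S" "S \<noteq> {}"
  shows "contractible_space (top_of_set (simplex_on S))"
proof -
  obtain p where p: "p \<in> simplex_on S" using simplex_on_nonempty[OF assms] by blast
  let ?h = "\<lambda>(s :: real, t) w. (1 - s) * t w + s * p w"
  have "continuous_on ({0..1} \<times> simplex_on S) ?h"
    unfolding case_prod_unfold
    by (intro continuous_on_coordinatewise_then_product continuous_on_add continuous_on_mult
        continuous_on_diff continuous_on_const continuous_on_fst continuous_on_id
        continuous_on_product_then_coordinatewise[OF continuous_on_snd])
  moreover have "?h \<in> {0..1} \<times> simplex_on S \<rightarrow> simplex_on S"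
    using p by (auto simp: simplex_on_def sum.distrib sum_distrib_left[symmetric])
  ultimately have "homotopic_with (\<lambda>_. True) (top_of_set (simplex_on S)) (top_of_set (simplex_on S)) id (\<lambda>_. p)"
    unfolding homotopic_with_def
    by (intro exI[of _ ?h]) (auto simp: prod_topology_subtopology_eu)
  then show ?thesis unfolding contractible_space_def by blast
qed

lemma product_of_simplices_point:
  fixes b :: "'c :: topological_space"
  assumes "\<And>v. v \<in> V \<Longrightarrow> finite (S v) \<and> S v \<noteq> {}"
  shows "subtopology (product_topology (\<lambda>_. euclidean) V) (\<Pi>\<^sub>E v\<in>V. simplex_on (S v))
    homotopy_equivalent_space top_of_set {b}"
proof (rule contractible_homotopy_equivalent_point)
  show "contractible_space (subtopology (product_topology (\<lambda>_. euclidean) V) (\<Pi>\<^sub>E v\<in>V. simplex_on (S v)))"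
    unfolding subtopology_product_topology contractible_space_product_topology
    using assms by (intro disjI2 ballI contractible_simplex_on) auto
  have "simplex_on (S v) \<noteq> {}" if "v \<in> V" for v
    using simplex_on_nonempty[of "S v"] assms[OF that] by blast
  then show "topspace (subtopology (product_topology (\<lambda>_. euclidean) V) (\<Pi>\<^sub>E v\<in>V. simplex_on (S v))) \<noteq> {}"
    unfolding subtopology_product_topology by (simp add: PiE_eq_empty_iff)
qed

lemma closedin_product_of_simplices:
  assumes "\<And>v. v \<in> V \<Longrightarrow> finite (S v)"
  shows "closedin (product_topology (\<lambda>_. euclidean) V) (\<Pi>\<^sub>E v\<in>V. simplex_on (S v))"
  using assms closed_simplex_on by (auto simp: closedin_product_topology)

text \<open>With integer labels, adjacency becomes divisibility of label differences, and no later
  argument has to treat the wrap-around of the cycle separately.\<close>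

lemma parcs_cycle_graph:
  assumes "0 < k"
  shows "(nat (a mod int k), nat (b mod int k)) \<in> parcs (cycle_graph k) \<longleftrightarrow>
    int k dvd b - a - 1 \<or> int k dvd b - a + 1"
proof -
  have suc: "nat (y mod int k) = Suc (nat (x mod int k)) mod k \<longleftrightarrow> int k dvd y - x - 1" for x y
  proof -
    have "nat (y mod int k) = Suc (nat (x mod int k)) mod k \<longleftrightarrow> y mod int k = int (Suc (nat (x mod int k)) mod k)"
    proof -
      have "0 \<le> y mod int k" using assms by simp
      then show ?thesis by (metis int_nat_eq nat_int)
    qed
    also have "int (Suc (nat (x mod int k)) mod k) = (x + 1) mod int k"
      using assms by (simp add: zmod_int mod_simps add.commute)
    also have "y mod int k = (x + 1) mod int k \<longleftrightarrow> int k dvd y - x - 1"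
      by (simp add: mod_eq_dvd_iff diff_diff_eq)
    finally show ?thesis .
  qed
  have "int k dvd a - b - 1 \<longleftrightarrow> int k dvd b - a + 1"
    using dvd_minus_iff[of "int k" "a - b - 1"] by (simp add: algebra_simps)
  moreover have "nat (x mod int k) < k" for x using assms by (simp add: nat_less_iff)
  ultimately show ?thesis by (auto simp: cycle_graph_def suc)
qed

lemma hom_cells_arc: "\<eta> \<in> hom_cells G H \<Longrightarrow> (u, v) \<in> parcs G \<Longrightarrow> x \<in> \<eta> u \<Longrightarrow> y \<in> \<eta> v \<Longrightarrow> (x, y) \<in> parcs H"
  unfolding hom_cells_def by blast

lemma hom_cells_vert: "\<eta> \<in> hom_cells G H \<Longrightarrow> v \<in> pverts G \<Longrightarrow> \<eta> v \<noteq> {} \<and> \<eta> v \<subseteq> pverts H"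
  unfolding hom_cells_def by (auto dest: PiE_mem)

lemma hom_complex_eq:
  "hom_complex G H = subtopology (product_topology (\<lambda>_. euclidean) (pverts G)) (topspace (hom_complex G H))"
  unfolding hom_complex_def topspace_subtopology by (rule subtopology_restrict[symmetric])

lemma topspace_hom_complex:
  "topspace (hom_complex G H) = (\<Union>\<eta>\<in>hom_cells G H. \<Pi>\<^sub>E v\<in>pverts G. simplex_on (\<eta> v))"
  unfolding hom_complex_def by auto

text \<open>A set closed in the ambient product is closed in the complex and inherits the same
  topology from both, so the pieces can be studied without reference to cells.\<close>

lemma points_circles_of_pieces:
  assumes fin: "finite \<A>"
    and clo: "\<And>A. A \<in> \<A> \<Longrightarrow> closedin (product_topology (\<lambda>_. euclidean) (pverts G)) A"
    and cover: "topspace (hom_complex G H) = \<Union>\<A>" and disj: "disjoint \<A>"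
    and type: "\<And>A. A \<in> \<A> \<Longrightarrow> \<exists>Y\<in>{top_of_set {0::complex}, top_of_set (sphere 0 1)}.
        subtopology (product_topology (\<lambda>_. euclidean) (pverts G)) A homotopy_equivalent_space Y"
  shows "\<exists>(I :: nat set) (X :: nat \<Rightarrow> complex topology).
           (\<forall>i \<in> I. X i = top_of_set {0} \<or> X i = top_of_set (sphere 0 1)) \<and>
           hom_complex G H homotopy_equivalent_space sum_topology X I"
proof (rule homotopy_equivalent_points_circles[OF fin _ cover disj])
  fix A assume A: "A \<in> \<A>"
  then have sub: "A \<subseteq> topspace (hom_complex G H)" using cover by blast
  show "closedin (hom_complex G H) A"
    by (subst hom_complex_eq) (rule closedin_subset_topspace[OF clo[OF A] sub])
  have "subtopology (hom_complex G H) A = subtopology (product_topology (\<lambda>_. euclidean) (pverts G)) A"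
    by (subst hom_complex_eq) (simp only: subtopology_subtopology Int_absorb1[OF sub])
  then show "\<exists>Y\<in>{top_of_set {0::complex}, top_of_set (sphere 0 1)}.
      subtopology (hom_complex G H) A homotopy_equivalent_space Y"
    using type[OF A] by simp
qed

section \<open>Graphs without arcs and the case of the square\<close>

lemma hom_complex_no_arcs:
  assumes "parcs G = {}" "0 < k"
  shows "topspace (hom_complex G (cycle_graph k)) = (\<Pi>\<^sub>E v\<in>pverts G. simplex_on {..<k})"
proof
  show "topspace (hom_complex G (cycle_graph k)) \<subseteq> (\<Pi>\<^sub>E v\<in>pverts G. simplex_on {..<k})"
    unfolding topspace_hom_complex
  proof (intro UN_least PiE_mono simplex_on_mono)
    fix \<eta> v assume "\<eta> \<in> hom_cells G (cycle_graph k)" "v \<in> pverts G"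
    then show "\<eta> v \<subseteq> {..<k}" by (auto simp: hom_cells_def cycle_graph_def dest: PiE_mem)
  qed simp
  \<comment> \<open>With no arcs to respect, the largest function is itself a cell, and all other
    cells are faces of it.\<close>
  have "(\<lambda>v\<in>pverts G. {..<k}) \<in> hom_cells G (cycle_graph k)"
    using assms by (auto simp: hom_cells_def cycle_graph_def)
  moreover have "(\<Pi>\<^sub>E v\<in>pverts G. simplex_on {..<k}) = (\<Pi>\<^sub>E v\<in>pverts G. simplex_on ((\<lambda>v\<in>pverts G. {..<k}) v))"
    by (rule PiE_cong) simp
  ultimately show "(\<Pi>\<^sub>E v\<in>pverts G. simplex_on {..<k}) \<subseteq> topspace (hom_complex G (cycle_graph k))"
    unfolding topspace_hom_complex by blast
qed

lemma parcs_square: "(x, y) \<in> parcs (cycle_graph 4) \<longleftrightarrow> x < 4 \<and> y < 4 \<and> (x \<in> {0, 2} \<longleftrightarrow> y \<notin> {0, 2})"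
proof (cases "x < 4 \<and> y < 4")
  case True
  then have "x \<in> {0, 1, 2, 3}" "y \<in> {0, 1, 2, 3}" by auto
  then show ?thesis by (elim insertE emptyE; simp add: cycle_graph_def)
qed (auto simp: cycle_graph_def)

text \<open>The square is complete bipartite, so every cell is a face of one assigning a whole side to each vertex.\<close>

lemma hom_complex_square:
  assumes arcs: "\<And>u v. (u, v) \<in> parcs G \<Longrightarrow> u \<in> pverts G \<and> v \<in> pverts G"
    and nbr: "\<And>v. v \<in> pverts G \<Longrightarrow> \<exists>u. (u, v) \<in> parcs G"
  shows "topspace (hom_complex G (cycle_graph 4)) =
    (\<Union>\<eta>\<in>{\<eta> \<in> pverts G \<rightarrow>\<^sub>E {{0, 2}, {1, 3}}. \<forall>(u, v)\<in>parcs G. \<eta> u \<noteq> \<eta> v}. \<Pi>\<^sub>E v\<in>pverts G. simplex_on (\<eta> v))"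
    (is "_ = (\<Union>\<eta>\<in>?M. ?C \<eta>)")
proof
  have "?M \<subseteq> hom_cells G (cycle_graph 4)"
  proof
    fix \<eta> assume \<eta>: "\<eta> \<in> ?M"
    have mem: "\<eta> v \<in> {{0, 2}, {1, 3}}" if "v \<in> pverts G" for v
      using \<eta> that by blast
    show "\<eta> \<in> hom_cells G (cycle_graph 4)"
      unfolding hom_cells_def
    proof (intro CollectI conjI)
      show "\<eta> \<in> pverts G \<rightarrow>\<^sub>E {S. S \<noteq> {} \<and> S \<subseteq> pverts (cycle_graph 4)}"
      proof (rule PiE_I)
        fix v assume "v \<in> pverts G"
        from mem[OF this] show "\<eta> v \<in> {S. S \<noteq> {} \<and> S \<subseteq> pverts (cycle_graph 4)}"
          by (auto simp: cycle_graph_def)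
      qed (use \<eta> in \<open>auto dest: PiE_arb\<close>)
      show "\<forall>(u, v)\<in>parcs G. \<forall>x\<in>\<eta> u. \<forall>y\<in>\<eta> v. (x, y) \<in> parcs (cycle_graph 4)"
      proof clarify
        fix u v x y assume uv: "(u, v) \<in> parcs G" and xy: "x \<in> \<eta> u" "y \<in> \<eta> v"
        have "\<eta> u \<noteq> \<eta> v" using \<eta> uv by auto
        then show "(x, y) \<in> parcs (cycle_graph 4)"
          using mem[of u] mem[of v] arcs[OF uv] xy by (auto simp: parcs_square)
      qed
    qed
  qed
  then show "(\<Union>\<eta>\<in>?M. ?C \<eta>) \<subseteq> topspace (hom_complex G (cycle_graph 4))"
    unfolding topspace_hom_complex by (rule UN_mono) (rule subset_refl)
  show "topspace (hom_complex G (cycle_graph 4)) \<subseteq> (\<Union>\<eta>\<in>?M. ?C \<eta>)"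
    unfolding topspace_hom_complex
  proof (intro UN_least)
    fix \<eta> assume \<eta>: "\<eta> \<in> hom_cells G (cycle_graph 4)"
    let ?\<eta> = "\<lambda>v\<in>pverts G. if \<eta> v \<subseteq> {0, 2} then {0, 2} else {1, 3 :: nat}"
    have ne: "\<eta> v \<noteq> {}" "\<eta> v \<subseteq> {..<4}" if "v \<in> pverts G" for v
      using hom_cells_vert[OF \<eta> that] by (simp_all add: cycle_graph_def)
    have adj: "x \<in> {0, 2} \<longleftrightarrow> y \<notin> {0, 2}" if "(u, v) \<in> parcs G" "x \<in> \<eta> u" "y \<in> \<eta> v" for u v x y
      using hom_cells_arc[OF \<eta> that] by (simp only: parcs_square)
    have sub: "\<eta> v \<subseteq> ?\<eta> v" if v: "v \<in> pverts G" for v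
    proof -
      \<comment> \<open>All elements of \<open>\<eta> v\<close> are adjacent to this one
        \<open>x\<close>, so they lie together on the side opposite to it.\<close>
      obtain u where u: "(u, v) \<in> parcs G" using nbr[OF v] by blast
      then obtain x where x: "x \<in> \<eta> u" using ne(1)[of u] arcs by blast
      have "\<eta> v \<subseteq> {1, 3}" if "\<not> \<eta> v \<subseteq> {0, 2}"
      proof
        fix y assume y: "y \<in> \<eta> v"
        from that obtain z where "z \<in> \<eta> v" "z \<notin> {0, 2}" by blast
        then have "y \<notin> {0, 2}" using adj[OF u x] y by blast
        moreover have "y < 4" using ne(2)[OF v] y by auto
        ultimately show "y \<in> {1, 3}" by auto
      qed
      then show ?thesis using v by simp
    qed
    have "?\<eta> u \<noteq> ?\<eta> v" if uv: "(u, v) \<in> parcs G" for u v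
    proof -
      obtain x y where xy: "x \<in> \<eta> u" "y \<in> \<eta> v" using ne(1) arcs[OF uv] by blast
      have side: "\<eta> w \<subseteq> {0, 2} \<longleftrightarrow> z \<in> {0, 2}" if "w \<in> pverts G" "z \<in> \<eta> w" for w z
        using sub[OF that(1)] that by (auto split: if_splits)
      have "\<eta> u \<subseteq> {0, 2} \<longleftrightarrow> \<not> \<eta> v \<subseteq> {0, 2}"
        using side[OF _ xy(1)] side[OF _ xy(2)] adj[OF uv xy] arcs[OF uv] by blast
      moreover have "{0, 2} \<noteq> {1, 3 :: nat}" by auto
      ultimately show ?thesis using arcs[OF uv] by auto
    qed
    then have "\<forall>(u, v)\<in>parcs G. ?\<eta> u \<noteq> ?\<eta> v" by (intro ballI) (simp only: split_paired_all case_prod_conv not_False_eq_True)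
    moreover have "?\<eta> \<in> pverts G \<rightarrow>\<^sub>E {{0, 2}, {1, 3}}" by simp
    ultimately have mem: "?\<eta> \<in> ?M" by (intro CollectI conjI)
    have "?C \<eta> \<subseteq> ?C ?\<eta>"
      using sub by (intro PiE_mono simplex_on_mono) auto
    also have "?C ?\<eta> \<subseteq> (\<Union>\<eta>\<in>?M. ?C \<eta>)" by (rule UN_upper[OF mem, of ?C])
    finally show "?C \<eta> \<subseteq> (\<Union>\<eta>\<in>?M. ?C \<eta>)" .
  qed
qed

lemma points_circles_square:
  assumes "finite (pverts G)" "\<And>u v. (u, v) \<in> parcs G \<Longrightarrow> u \<in> pverts G \<and> v \<in> pverts G"
    and "\<And>v. v \<in> pverts G \<Longrightarrow> \<exists>u. (u, v) \<in> parcs G"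
  shows "\<exists>(I :: nat set) (X :: nat \<Rightarrow> complex topology).
           (\<forall>i \<in> I. X i = top_of_set {0} \<or> X i = top_of_set (sphere 0 1)) \<and>
           hom_complex G (cycle_graph 4) homotopy_equivalent_space sum_topology X I"
proof (rule points_circles_of_pieces)
  let ?M = "{\<eta> \<in> pverts G \<rightarrow>\<^sub>E {{0, 2}, {1, 3 :: nat}}. \<forall>(u, v)\<in>parcs G. \<eta> u \<noteq> \<eta> v}"
  let ?C = "\<lambda>\<eta>. \<Pi>\<^sub>E v\<in>pverts G. simplex_on (\<eta> v)"
  have fin: "finite (\<eta> v) \<and> \<eta> v \<noteq> {}" if "\<eta> \<in> ?M" "v \<in> pverts G" for \<eta> v
  proof -
    have "\<eta> v \<in> {{0, 2}, {1, 3}}" using that by blast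
    then show ?thesis by auto
  qed
  show "finite (?C ` ?M)"
    using assms(1) by (intro finite_imageI finite_subset[OF _ finite_PiE[of "pverts G" "\<lambda>_. {{0, 2}, {1, 3}}"]]) auto
  show "topspace (hom_complex G (cycle_graph 4)) = \<Union> (?C ` ?M)"
    using hom_complex_square[OF assms(2,3)] by simp
  fix A assume "A \<in> ?C ` ?M"
  then obtain \<eta> where \<eta>: "\<eta> \<in> ?M" and A: "A = ?C \<eta>" by (rule imageE)
  show "closedin (product_topology (\<lambda>_. euclidean) (pverts G)) A"
    unfolding A using fin[OF \<eta>] by (intro closedin_product_of_simplices) auto
  show "\<exists>Y\<in>{top_of_set {0::complex}, top_of_set (sphere 0 1)}.
      subtopology (product_topology (\<lambda>_. euclidean) (pverts G)) A homotopy_equivalent_space Y"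
    unfolding A by (intro bexI[of _ "top_of_set {0}"] product_of_simplices_point fin[OF \<eta>]) auto
next
  let ?M = "{\<eta> \<in> pverts G \<rightarrow>\<^sub>E {{0, 2}, {1, 3 :: nat}}. \<forall>(u, v)\<in>parcs G. \<eta> u \<noteq> \<eta> v}"
  let ?C = "\<lambda>\<eta>. \<Pi>\<^sub>E v\<in>pverts G. simplex_on (\<eta> v)"
  \<comment> \<open>At each vertex a common point is supported on both sides chosen there, and the
    two sides of the square are disjoint.\<close>
  have eq: "\<eta> = \<eta>'" if M: "\<eta> \<in> ?M" "\<eta>' \<in> ?M" and x: "x \<in> ?C \<eta>" "x \<in> ?C \<eta>'" for \<eta> \<eta>' x
  proof -
    have PiE: "\<eta> \<in> pverts G \<rightarrow>\<^sub>E {{0, 2}, {1, 3}}" "\<eta>' \<in> pverts G \<rightarrow>\<^sub>E {{0, 2}, {1, 3}}"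
      using M by (simp_all only: mem_Collect_eq)
    show ?thesis
    proof (rule PiE_ext[OF PiE])
      fix v assume v: "v \<in> pverts G"
      have "x v \<in> simplex_on (\<eta> v) \<inter> simplex_on (\<eta>' v)"
        using PiE_mem[OF x(1) v] PiE_mem[OF x(2) v] by simp
      then have "\<eta> v \<inter> \<eta>' v \<noteq> {}" using simplex_on_disjoint[of "\<eta> v" "\<eta>' v"] by auto
      then show "\<eta> v = \<eta>' v" using PiE_mem[OF PiE(1) v] PiE_mem[OF PiE(2) v] by auto
    qed
  qed
  show "disjoint (?C ` ?M)"
  proof (rule disjointI)
    fix A B assume "A \<in> ?C ` ?M" "B \<in> ?C ` ?M" and ne: "A \<noteq> B"
    then obtain \<eta> \<eta>' where \<eta>: "\<eta> \<in> ?M" "A = ?C \<eta>" "\<eta>' \<in> ?M" "B = ?C \<eta>'" by (elim imageE)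
    have "\<eta> = \<eta>'" if "x \<in> A" "x \<in> B" for x
      using eq[OF \<eta>(1,3)] that unfolding \<eta>(2,4) .
    with ne \<eta>(2,4) show "A \<inter> B = {}" by (metis disjoint_iff)
  qed
qed

section \<open>The lattice of lifts\<close>

lemma floor_min: "\<lfloor>min x y\<rfloor> = min \<lfloor>x\<rfloor> \<lfloor>y\<rfloor>" for x y :: real
  by (auto simp: min_def floor_mono intro: antisym floor_mono)

lemma ceiling_min: "\<lceil>min x y\<rceil> = min \<lceil>x\<rceil> \<lceil>y\<rceil>" for x y :: real
  by (auto simp: min_def ceiling_mono intro: antisym ceiling_mono)

lemma floor_max: "\<lfloor>max x y\<rfloor> = max \<lfloor>x\<rfloor> \<lfloor>y\<rfloor>" for x y :: real
  by (auto simp: max_def floor_mono intro: antisym floor_mono)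

lemma ceiling_max: "\<lceil>max x y\<rceil> = max \<lceil>x\<rceil> \<lceil>y\<rceil>" for x y :: real
  by (auto simp: max_def ceiling_mono intro: antisym ceiling_mono)

text \<open>The condition asks for an integer between \<open>y\<close> and \<open>x\<close>. It
  removes from the half plane \<open>y \<le> x\<close> the open unit squares along the diagonal, so
  the complement is a union of open sets.\<close>

lemma closed_ceiling_le_floor: "closed {(x :: real, y :: real). \<lceil>y\<rceil> \<le> \<lfloor>x\<rfloor>}"
proof -
  have "- {(x :: real, y :: real). \<lceil>y\<rceil> \<le> \<lfloor>x\<rfloor>} =
      {(x, y). x < y} \<union> (\<Union>n::int. {of_int n<..<of_int n + 1} \<times> {of_int n<..<of_int n + 1})"
    (is "_ = ?R")
  proof (intro set_eqI, clarify)
    fix x y :: real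
    show "(x, y) \<in> - {(x :: real, y :: real). \<lceil>y\<rceil> \<le> \<lfloor>x\<rfloor>} \<longleftrightarrow> (x, y) \<in> ?R"
    proof
      assume "(x, y) \<in> - {(x :: real, y :: real). \<lceil>y\<rceil> \<le> \<lfloor>x\<rfloor>}"
      then have "real_of_int \<lfloor>x\<rfloor> < y" by (simp add: not_le less_ceiling_iff)
      then have "x < y \<or> (x, y) \<in> {of_int \<lfloor>x\<rfloor><..<of_int \<lfloor>x\<rfloor> + 1} \<times> {of_int \<lfloor>x\<rfloor><..<of_int \<lfloor>x\<rfloor> + 1}"
        using floor_correct[of x] by (cases "x < y") (auto, linarith)
      then show "(x, y) \<in> ?R" by blast
    next
      assume "(x, y) \<in> ?R"
      then consider "x < y" | n where "of_int n < y" "x < of_int n + 1" by auto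
      then have "\<lfloor>x\<rfloor> < \<lceil>y\<rceil>"
      proof cases
        case 1
        then show ?thesis by linarith
      next
        case 2
        then have "\<lfloor>x\<rfloor> \<le> n" "n < \<lceil>y\<rceil>" by (simp_all add: floor_le_iff less_ceiling_iff)
        then show ?thesis by simp
      qed
      then show "(x, y) \<in> - {(x :: real, y :: real). \<lceil>y\<rceil> \<le> \<lfloor>x\<rfloor>}" by simp
    qed
  qed
  moreover have "open {(x :: real, y). x < y}"
    using open_Collect_less[of "fst :: real \<times> real \<Rightarrow> real" snd]
    by (simp add: case_prod_unfold continuous_on_fst continuous_on_snd)
  ultimately show ?thesis
    unfolding closed_def by (simp add: open_Un open_UN open_Times)
qed

text \<open>The box between the floors and ceilings of \<open>d\<close> is the smallest closed cube
  of the integer grid containing \<open>d\<close>; by convexity the segment from \<open>d\<close> to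
  any point of it stays inside.\<close>

lemma path_component_box:
  fixes d d' :: "'i \<Rightarrow> real"
  assumes "\<And>e. \<lbrakk>\<And>i. of_int \<lfloor>d i\<rfloor> \<le> e i; \<And>i. e i \<le> of_int \<lceil>d i\<rceil>; \<And>i. i \<notin> V \<Longrightarrow> e i = e r\<rbrakk> \<Longrightarrow> e \<in> S"
    and d': "\<And>i. of_int \<lfloor>d i\<rfloor> \<le> d' i" "\<And>i. d' i \<le> of_int \<lceil>d i\<rceil>"
    and off: "\<And>i. i \<notin> V \<Longrightarrow> d i = d r" "\<And>i. i \<notin> V \<Longrightarrow> d' i = d' r"
  shows "path_component S d d'"
proof (rule path_component_segment, rule assms(1))
  fix t :: real and i assume t: "t \<in> {0..1}"
  have "(1 - t) * d i + t * d' i \<in> {of_int \<lfloor>d i\<rfloor>..of_int \<lceil>d i\<rceil>}"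
    using convexD_alt[of "{of_int \<lfloor>d i\<rfloor>..of_int \<lceil>d i\<rceil>}" "d i" "d' i" t] d'[of i] t by simp
  then show "of_int \<lfloor>d i\<rfloor> \<le> (1 - t) * d i + t * d' i" "(1 - t) * d i + t * d' i \<le> of_int \<lceil>d i\<rceil>"
    by auto
qed (use off in auto)

text \<open>Connectedness is stated as an induction principle along arcs from the root, the form in
  which heights are compared with the height of \<open>r\<close>. The assumption \<open>nbr\<close>
  bounds the cells: the set at a vertex lies in the neighbourhood of a single vertex of the
  cycle.\<close>

locale cycle_homs =
  fixes G :: "'a pair_pre_digraph" and r :: 'a and k :: nat
  assumes fin: "finite (pverts G)"
    and root: "r \<in> pverts G"
    and arcs: "\<And>u v. (u, v) \<in> parcs G \<Longrightarrow> u \<in> pverts G \<and> v \<in> pverts G"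
    and sym: "\<And>u v. (u, v) \<in> parcs G \<Longrightarrow> (v, u) \<in> parcs G"
    and conn: "\<And>P v. \<lbrakk>P r; \<And>u v. (u, v) \<in> parcs G \<Longrightarrow> P u \<Longrightarrow> P v; v \<in> pverts G\<rbrakk> \<Longrightarrow> P v"
    and nbr: "\<And>v. v \<in> pverts G \<Longrightarrow> \<exists>u. (v, u) \<in> parcs G"
    and k3: "3 \<le> k" and k4: "k \<noteq> 4"
begin

definition hom :: "('a \<Rightarrow> int) \<Rightarrow> bool" where
  "hom f \<longleftrightarrow> (\<forall>(u, v) \<in> parcs G. int k dvd f v - f u - 1 \<or> int k dvd f v - f u + 1)"

text \<open>Orients every edge in the direction in which a homomorphism increases by 1; as
  \<open>k\<close> does not divide 2, exactly one of the two opposite arcs qualifies.\<close>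

definition up :: "('a \<Rightarrow> int) \<Rightarrow> ('a \<times> 'a) set" where
  "up f = {(u, v) \<in> parcs G. int k dvd f v - f u - 1}"

text \<open>
  Homomorphisms to the cycle are represented by integer labels modulo \<open>k\<close>. A point \<open>d\<close> of \<open>lift f\<close>
  stands for moving each vertex \<open>v\<close> from \<open>f v\<close> through \<open>2 * d v\<close>: as two-element cells of a vertex are
  pairs at distance 2, integral \<open>d\<close> are homomorphisms and fractional parts are barycentric coordinates.
  For an arc along which \<open>f\<close> increases, the pairs allowed by \<open>lift\<close> form a staircase in the plane, which is
  totally ordered; this is why \<open>lift f\<close> is closed under minima and maxima.
  Off the vertex set, \<open>d\<close> takes the value \<open>d r\<close>, so that translations act uniformly and
  bounded closed subsets are compact.
\<close>

definition lift :: "('a \<Rightarrow> int) \<Rightarrow> ('a \<Rightarrow> real) set" where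
  "lift f = {d. (\<forall>(u, v) \<in> up f. \<lceil>d v\<rceil> \<le> \<lfloor>d u\<rfloor> \<and> \<lceil>d u\<rceil> \<le> \<lfloor>d v\<rfloor> + 1) \<and> (\<forall>v. v \<notin> pverts G \<longrightarrow> d v = d r)}"

definition component :: "('a \<Rightarrow> int) \<Rightarrow> ('a \<Rightarrow> real) set" where
  "component f = path_component_set (lift f) (\<lambda>_. 0)"

text \<open>Barycentric coordinates of a point that travels along the closed polygon with corners
  \<open>a\<close>, \<open>a + 2\<close>, \<open>a + 4\<close> and so on modulo \<open>k\<close>. At
  integral \<open>y\<close> the second weight vanishes and a corner is left.\<close>

definition pos :: "int \<Rightarrow> real \<Rightarrow> nat \<Rightarrow> real" where
  "pos a y w = (1 - frac y) * of_bool (int w = (a + 2 * \<lfloor>y\<rfloor>) mod int k) +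
     frac y * of_bool (int w = (a + 2 * \<lfloor>y\<rfloor> + 2) mod int k)"

definition proj :: "('a \<Rightarrow> int) \<Rightarrow> ('a \<Rightarrow> real) \<Rightarrow> 'a \<Rightarrow> nat \<Rightarrow> real" where
  "proj f d = (\<lambda>v\<in>pverts G. pos (f v) (d v))"

definition piece :: "('a \<Rightarrow> int) \<Rightarrow> ('a \<Rightarrow> nat \<Rightarrow> real) set" where
  "piece f = proj f ` component f"

section \<open>Closure properties of the lift and of its component\<close>

lemma homD: "hom f \<Longrightarrow> (u, v) \<in> parcs G \<Longrightarrow> (u, v) \<in> up f \<or> (v, u) \<in> up f"
  using sym[of u v] dvd_minus_iff[of "int k" "f v - f u + 1"] unfolding hom_def up_def
  by (auto simp: algebra_simps)

lemma k_dvd_small: "int k dvd m \<Longrightarrow> \<bar>m\<bar> < 3 \<Longrightarrow> m = 0"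
  using k3 dvd_imp_le_int[of m "int k"] by (cases "m = 0") auto

text \<open>Says that \<open>a + 2\<close> and \<open>a - 2\<close> are different residues, so that
  the pair of corners determines the direction of a move. The square is treated apart because this
  fails there.\<close>

lemma k_dvd_4: "\<not> int k dvd 4"
proof
  assume "int k dvd 4"
  then have "k dvd 4" by (metis int_dvd_int_iff of_nat_numeral)
  then have "k \<le> 4" by (rule dvd_imp_le) simp
  then have "k = 3" using k3 k4 by auto
  with \<open>k dvd 4\<close> show False by auto
qed

lemma liftD:
  assumes "d \<in> lift f" "(u, v) \<in> up f"
  shows "\<lceil>d v\<rceil> \<le> \<lfloor>d u\<rfloor>" "\<lceil>d u\<rceil> \<le> \<lfloor>d v\<rfloor> + 1" "\<lfloor>d v\<rfloor> \<le> \<lfloor>d u\<rfloor>" "\<lfloor>d u\<rfloor> \<le> \<lfloor>d v\<rfloor> + 1"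
proof -
  show *: "\<lceil>d v\<rceil> \<le> \<lfloor>d u\<rfloor>" "\<lceil>d u\<rceil> \<le> \<lfloor>d v\<rfloor> + 1" using assms by (auto simp: lift_def)
  show "\<lfloor>d v\<rfloor> \<le> \<lfloor>d u\<rfloor>" "\<lfloor>d u\<rfloor> \<le> \<lfloor>d v\<rfloor> + 1"
    using * floor_le_ceiling[of "d u"] floor_le_ceiling[of "d v"] by linarith+
qed

lemma lift_off: "d \<in> lift f \<Longrightarrow> v \<notin> pverts G \<Longrightarrow> d v = d r"
  by (auto simp: lift_def)

lemma lift_0: "(\<lambda>_. 0) \<in> lift f"
  by (auto simp: lift_def)

text \<open>Floor and ceiling are monotone, hence commute with minima, and each staircase condition
  is an inequality between a ceiling and a floor; two such inequalities may be minimised side by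
  side.\<close>

lemma lift_min: "d \<in> lift f \<Longrightarrow> d' \<in> lift f \<Longrightarrow> (\<lambda>v. min (d v) (d' v)) \<in> lift f"
  unfolding lift_def floor_min ceiling_min mem_Collect_eq by fastforce

lemma lift_max: "d \<in> lift f \<Longrightarrow> d' \<in> lift f \<Longrightarrow> (\<lambda>v. max (d v) (d' v)) \<in> lift f"
  unfolding lift_def floor_max ceiling_max mem_Collect_eq by fastforce

lemma lift_shift: "d \<in> lift f \<Longrightarrow> (\<lambda>v. d v + of_int m) \<in> lift f"
  unfolding lift_def by auto

text \<open>Inside the closed cube of \<open>d\<close> floors can only grow and ceilings only
  shrink, while the staircase conditions bound ceilings by floors. So the lift is a union of closed
  cubes.\<close>

lemma lift_box:
  assumes "d \<in> lift f" "\<And>v. of_int \<lfloor>d v\<rfloor> \<le> d' v" "\<And>v. d' v \<le> of_int \<lceil>d v\<rceil>"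
    and "\<And>v. v \<notin> pverts G \<Longrightarrow> d' v = d' r"
  shows "d' \<in> lift f"
proof -
  have "\<lfloor>d v\<rfloor> \<le> \<lfloor>d' v\<rfloor>" "\<lceil>d' v\<rceil> \<le> \<lceil>d v\<rceil>" for v
    using assms(2,3) by (simp_all add: le_floor_iff ceiling_le_iff)
  then show ?thesis
    using assms(1,4) unfolding lift_def by (fastforce intro: order.trans)
qed

lemma lift_path_box:
  assumes "d \<in> lift f" "\<And>v. of_int \<lfloor>d v\<rfloor> \<le> d' v" "\<And>v. d' v \<le> of_int \<lceil>d v\<rceil>"
    and "\<And>v. v \<notin> pverts G \<Longrightarrow> d' v = d' r"
  shows "path_component (lift f) d d'"
  by (rule path_component_box[of d "pverts G" r]) (use assms lift_box lift_off in auto)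

lemma closed_lift: "closed (lift f)"
proof -
  let ?Q = "{(x :: real, y :: real). \<lceil>y\<rceil> \<le> \<lfloor>x\<rfloor>}"
  have "lift f = (\<Inter>p\<in>up f. (\<lambda>d. (d (fst p), d (snd p))) -` ?Q \<inter> (\<lambda>d. (d (snd p) + 1, d (fst p))) -` ?Q)
      \<inter> (\<Inter>v\<in>- pverts G. {d. d v = d r})"
    unfolding lift_def by (auto simp: case_prod_unfold)
  moreover have "closed ((\<lambda>d. (d u, d v)) -` ?Q)" "closed ((\<lambda>d. (d v + 1, d u)) -` ?Q)" for u v :: 'a
    by (intro closed_vimage closed_ceiling_le_floor continuous_on_Pair continuous_on_add
        continuous_on_const continuous_on_product_coordinates)+
  moreover have "closed {d::'a \<Rightarrow> real. d v = d r}" for v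
    by (intro closed_Collect_eq continuous_on_product_coordinates)
  ultimately show ?thesis by (simp only:) (intro closed_Int closed_INT ballI)
qed

text \<open>If \<open>d'\<close> in the lift is close to \<open>d\<close>, the rounding of
  \<open>d\<close> downwards lies in the closed cubes of both points. Both are then joined to the
  same integral point, so a component contains its limit points.\<close>

lemma closed_component: "closed (component f)"
proof -
  have *: "\<exists>T. open T \<and> d \<in> T \<and> T \<subseteq> - component f" if d: "d \<notin> component f" for d
  proof (cases "d \<in> lift f")
    case False
    then show ?thesis
      using closed_lift[of f] path_component_subset[of "lift f"]
      by (intro exI[of _ "- lift f"]) (auto simp: component_def)
  next
    case True
    \<comment> \<open>For a nonintegral coordinate this allows its open unit interval, for an
      integral one both adjacent intervals.\<close>
    let ?U = "\<Inter>v\<in>pverts G. {d' :: 'a \<Rightarrow> real. of_int \<lceil>d v\<rceil> - 1 < d' v \<and> d' v < of_int \<lfloor>d v\<rfloor> + 1}"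
    have "open {d' :: 'a \<Rightarrow> real. a < d' v \<and> d' v < b}" for a b :: real and v
      using open_Collect_less[of "\<lambda>_. a" "\<lambda>d'. d' v"] open_Collect_less[of "\<lambda>d'. d' v" "\<lambda>_. b"]
      by (intro open_Collect_conj) auto
    then have "open ?U" using fin by (intro open_INT ballI)
    moreover have "d \<in> ?U" by auto linarith
    moreover have "d' \<notin> component f" if d': "d' \<in> ?U" for d'
    proof
      assume "d' \<in> component f"
      then have path: "path_component (lift f) (\<lambda>_. 0) d'" and "d' \<in> lift f"
        using path_component_subset[of "lift f"] by (auto simp: component_def)
      let ?e = "\<lambda>v. real_of_int \<lfloor>d v\<rfloor>"
      have b: "\<lfloor>d' v\<rfloor> \<le> \<lfloor>d v\<rfloor>" "\<lfloor>d v\<rfloor> \<le> \<lceil>d' v\<rceil>" if "v \<in> pverts G" for v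
      proof -
        have *: "of_int \<lceil>d v\<rceil> - 1 < d' v" "d' v < of_int \<lfloor>d v\<rfloor> + 1" using d' that by auto
        show "\<lfloor>d' v\<rfloor> \<le> \<lfloor>d v\<rfloor>" using *(2) by linarith
        show "\<lfloor>d v\<rfloor> \<le> \<lceil>d' v\<rceil>" using *(1) by linarith
      qed
      have "\<lfloor>d' v\<rfloor> \<le> \<lfloor>d v\<rfloor>" "\<lfloor>d v\<rfloor> \<le> \<lceil>d' v\<rceil>" for v
        using b[of v] b[OF root] lift_off[OF True, of v] lift_off[OF \<open>d' \<in> lift f\<close>, of v]
        by (cases "v \<in> pverts G"; simp)+
      then have "path_component (lift f) d' ?e"
        using lift_off[OF True] by (intro lift_path_box \<open>d' \<in> lift f\<close>) auto
      moreover have "path_component (lift f) d ?e"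
        using lift_off[OF True] by (intro lift_path_box True) auto
      ultimately have "d \<in> component f"
        using path unfolding component_def by (metis mem_Collect_eq path_component_sym path_component_trans)
      with d show False by simp
    qed
    ultimately show ?thesis by blast
  qed
  show ?thesis unfolding closed_def by (subst open_subopen) (use * in auto)
qed

lemma component_subset: "component f \<subseteq> lift f"
  unfolding component_def by (rule path_component_subset)

lemma component_0: "(\<lambda>_. 0) \<in> component f"
  by (simp add: component_def path_component_refl lift_0)

text \<open>The pointwise minimum of two paths starting at the zero function starts there
  again.\<close>

lemma component_min:
  assumes "d \<in> component f" "d' \<in> component f"
  shows "(\<lambda>v. min (d v) (d' v)) \<in> component f"
proof -
  have "continuous_on UNIV (\<lambda>(d :: 'a \<Rightarrow> real, d'). \<lambda>v. min (d v) (d' v))"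
    unfolding case_prod_unfold
    by (intro continuous_on_coordinatewise_then_product continuous_on_min
        continuous_on_product_then_coordinatewise[OF continuous_on_fst]
        continuous_on_product_then_coordinatewise[OF continuous_on_snd] continuous_on_id)
  then show ?thesis
    using assms path_component_map2[of "lift f" "\<lambda>_. 0" d "\<lambda>_. 0" d'
        "\<lambda>d d' v. min (d v) (d' v)" "lift f"] lift_min by (simp add: component_def)
qed

lemma component_max:
  assumes "d \<in> component f" "d' \<in> component f"
  shows "(\<lambda>v. max (d v) (d' v)) \<in> component f"
proof -
  have "continuous_on UNIV (\<lambda>(d :: 'a \<Rightarrow> real, d'). \<lambda>v. max (d v) (d' v))"
    unfolding case_prod_unfold
    by (intro continuous_on_coordinatewise_then_product continuous_on_max
        continuous_on_product_then_coordinatewise[OF continuous_on_fst]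
        continuous_on_product_then_coordinatewise[OF continuous_on_snd] continuous_on_id)
  then show ?thesis
    using assms path_component_map2[of "lift f" "\<lambda>_. 0" d "\<lambda>_. 0" d'
        "\<lambda>d d' v. max (d v) (d' v)" "lift f"] lift_max by (simp add: component_def)
qed

lemma component_box:
  assumes "d \<in> component f" "\<And>v. of_int \<lfloor>d v\<rfloor> \<le> d' v" "\<And>v. d' v \<le> of_int \<lceil>d v\<rceil>"
    and "\<And>v. v \<notin> pverts G \<Longrightarrow> d' v = d' r"
  shows "d' \<in> component f"
proof -
  have "path_component (lift f) d d'"
    using assms component_subset[of f] by (intro lift_path_box) blast+
  then show ?thesis
    using assms(1) unfolding component_def by (auto intro: path_component_trans)
qed

lemma component_off: "d \<in> component f \<Longrightarrow> v \<notin> pverts G \<Longrightarrow> d v = d r"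
  using component_subset lift_off by blast

lemma component_floor: "d \<in> component f \<Longrightarrow> (\<lambda>v. of_int \<lfloor>d v\<rfloor>) \<in> component f"
  by (rule component_box[of d]) (auto simp: component_off)

lemma component_ceiling: "d \<in> component f \<Longrightarrow> (\<lambda>v. of_int \<lceil>d v\<rceil>) \<in> component f"
  by (rule component_box[of d]) (auto simp: component_off le_of_int_ceiling floor_le_ceiling)

lemma component_shift:
  assumes "d \<in> component f" "(\<lambda>_. of_int m) \<in> component f"
  shows "(\<lambda>v. d v + of_int m) \<in> component f"
proof -
  have "continuous_on UNIV (\<lambda>(d :: 'a \<Rightarrow> real) v. d v + of_int m)"
    by (intro continuous_on_coordinatewise_then_product continuous_on_add continuous_on_const
        continuous_on_product_coordinates)
  then have "path_component (lift f) (\<lambda>v. 0 + of_int m) (\<lambda>v. d v + of_int m)"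
    using path_component_map[of "lift f" "\<lambda>_. 0" d "\<lambda>d v. d v + of_int m" "lift f"] assms(1) lift_shift
    by (simp add: component_def)
  then show ?thesis
    using assms(2) unfolding component_def by (auto intro: path_component_trans)
qed

text \<open>A translation that keeps one point of the component inside it moves the zero function
  within the component as well, so periods can be read off from constant functions.\<close>

lemma component_shift_minus:
  assumes "d \<in> component f" "(\<lambda>v. d v + of_int m) \<in> component f"
  shows "(\<lambda>_. of_int m) \<in> component f"
proof -
  have "continuous_on UNIV (\<lambda>(d :: 'a \<Rightarrow> real) v. d v + of_int m)"
    by (intro continuous_on_coordinatewise_then_product continuous_on_add continuous_on_const
        continuous_on_product_coordinates)
  then have "path_component (lift f) (\<lambda>v. 0 + of_int m) (\<lambda>v. d v + of_int m)"
    using path_component_map[of "lift f" "\<lambda>_. 0" d "\<lambda>d v. d v + of_int m" "lift f"] assms(1) lift_shift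
    by (simp add: component_def)
  then show ?thesis
    using assms(2) unfolding component_def
    by (metis add_0 mem_Collect_eq path_component_sym path_component_trans)
qed

section \<open>From heights to barycentric coordinates\<close>

lemma continuous_on_pos: "continuous_on UNIV (\<lambda>y. pos a y w)"
proof -
  \<comment> \<open>The affine formula of the \<open>n\<close>-th segment, extended to the whole
    line; consecutive ones agree at the common corner.\<close>
  define g where "g n y = (1 - (y - of_int n)) * of_bool (int w = (a + 2 * n) mod int k) +
     (y - of_int n) * of_bool (int w = (a + 2 * n + 2) mod int k)" for n and y :: real
  have "continuous_on UNIV (\<lambda>y. g \<lfloor>y\<rfloor> y)"
    by (rule continuous_floor_glue)
       (auto simp: g_def algebra_simps intro!: continuous_intros)
  then show ?thesis by (simp add: g_def pos_def frac_def)
qed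

lemma pos_add_int: "pos a (y + of_int m) = pos (a + 2 * m) y"
  by (auto simp: pos_def fun_eq_iff algebra_simps)

lemma pos_cong:
  assumes "int k dvd a - a'"
  shows "pos a = pos a'"
proof -
  have "(a + m) mod int k = (a' + m) mod int k" for m
    using assms by (simp add: mod_eq_dvd_iff)
  then show ?thesis by (auto simp: pos_def fun_eq_iff add.assoc)
qed

text \<open>The starting corner always has positive weight. If the starting corners differed, each
  would be the end corner of the other segment, so that one pair is traversed in both directions;
  going once around it gives \<open>k\<close> dividing 4.\<close>

lemma pos_eqD:
  assumes "pos a y = pos a' y'"
  shows "frac y = frac y'" "int k dvd (a + 2 * \<lfloor>y\<rfloor>) - (a' + 2 * \<lfloor>y'\<rfloor>)"
proof -
  let ?A = "(a + 2 * \<lfloor>y\<rfloor>) mod int k" and ?A' = "(a' + 2 * \<lfloor>y'\<rfloor>) mod int k"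
  let ?B = "(a + 2 * \<lfloor>y\<rfloor> + 2) mod int k" and ?B' = "(a' + 2 * \<lfloor>y'\<rfloor> + 2) mod int k"
  have k0: "int k > 0" using k3 by simp
  have ne: "?A \<noteq> ?B" "?A' \<noteq> ?B'"
    using k_dvd_small[of 2] k_dvd_small[of "-2"] by (auto simp: mod_eq_dvd_iff)
  have eq: "(1 - frac y) * of_bool (m = ?A) + frac y * of_bool (m = ?B) =
        (1 - frac y') * of_bool (m = ?A') + frac y' * of_bool (m = ?B')" if "0 \<le> m" for m
    using fun_cong[OF assms, of "nat m"] that by (simp add: pos_def)
  have "?A = ?A'"
  proof (rule ccontr)
    assume "?A \<noteq> ?A'"
    then have "?A = ?B'" "?A' = ?B"
      using eq[of ?A] eq[of ?A'] ne frac_lt_1[of y] frac_lt_1[of y'] k0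
      by (auto simp: of_bool_def split: if_splits)
    then have "int k dvd (a + 2 * \<lfloor>y\<rfloor>) - (a' + 2 * \<lfloor>y'\<rfloor> + 2)" "int k dvd (a' + 2 * \<lfloor>y'\<rfloor>) - (a + 2 * \<lfloor>y\<rfloor> + 2)"
      by (simp_all add: mod_eq_dvd_iff)
    from dvd_add[OF this] have "int k dvd -4" by (simp add: algebra_simps)
    then show False using k_dvd_4 by (simp only: dvd_minus_iff)
  qed
  then show "int k dvd (a + 2 * \<lfloor>y\<rfloor>) - (a' + 2 * \<lfloor>y'\<rfloor>)" by (simp add: mod_eq_dvd_iff)
  show "frac y = frac y'"
    using eq[of ?A] \<open>?A = ?A'\<close> ne k0 by auto
qed

lemma proj_shift:
  assumes "int k dvd 2 * m"
  shows "proj f (\<lambda>v. d v + of_int m) = proj f d"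
proof -
  have "pos (f v + 2 * m) = pos (f v)" for v
    using assms by (intro pos_cong) simp
  then show ?thesis by (simp add: proj_def pos_add_int)
qed

text \<open>The fibres of \<open>proj f\<close> are orbits of translations. Between adjacent
  vertices the integral height differences vary by at most 1, while \<open>k\<close>, being at least
  3, divides twice the variation; so the difference is constant, first along arcs and then by
  connectedness.\<close>

lemma proj_eqD:
  assumes f: "hom f" and d: "d \<in> lift f" "d' \<in> lift f" and eq: "proj f d = proj f d'"
  obtains m where "int k dvd 2 * m" "d' = (\<lambda>v. d v + of_int m)"
proof -
  have pos: "frac (d v) = frac (d' v)" "int k dvd 2 * (\<lfloor>d' v\<rfloor> - \<lfloor>d v\<rfloor>)" if "v \<in> pverts G" for v
  proof -
    have "pos (f v) (d v) = pos (f v) (d' v)"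
      using fun_cong[OF eq, of v] that by (simp add: proj_def)
    from pos_eqD[OF this[symmetric]] pos_eqD(1)[OF this]
    show "frac (d v) = frac (d' v)" "int k dvd 2 * (\<lfloor>d' v\<rfloor> - \<lfloor>d v\<rfloor>)" by (simp_all add: algebra_simps)
  qed
  let ?m = "\<lfloor>d' r\<rfloor> - \<lfloor>d r\<rfloor>"
  have "\<lfloor>d' v\<rfloor> - \<lfloor>d v\<rfloor> = ?m" if "v \<in> pverts G" for v
    using that
  proof (rule conn[rotated 2])
    fix u v assume uv: "(u, v) \<in> parcs G" and IH: "\<lfloor>d' u\<rfloor> - \<lfloor>d u\<rfloor> = ?m"
    let ?x = "(\<lfloor>d' v\<rfloor> - \<lfloor>d v\<rfloor>) - (\<lfloor>d' u\<rfloor> - \<lfloor>d u\<rfloor>)"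
    have "int k dvd 2 * (\<lfloor>d' v\<rfloor> - \<lfloor>d v\<rfloor>) - 2 * (\<lfloor>d' u\<rfloor> - \<lfloor>d u\<rfloor>)"
      using arcs[OF uv] by (intro dvd_diff pos) auto
    then have "int k dvd 2 * ?x" by (simp add: algebra_simps)
    moreover have "\<bar>?x\<bar> \<le> 1"
      using homD[OF f uv]
    proof
      assume "(u, v) \<in> up f"
      then show ?thesis using liftD(3,4)[OF d(1)] liftD(3,4)[OF d(2)] by fastforce
    next
      assume "(v, u) \<in> up f"
      then show ?thesis using liftD(3,4)[OF d(1)] liftD(3,4)[OF d(2)] by fastforce
    qed
    moreover have "x = 0" if "int k dvd 2 * x" "\<bar>x\<bar> \<le> 1" for x
      using k_dvd_small[of "2 * x"] that by linarith
    ultimately have "?x = 0" by blast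
    with IH show "\<lfloor>d' v\<rfloor> - \<lfloor>d v\<rfloor> = ?m" by simp
  qed simp
  then have "real_of_int \<lfloor>d' v\<rfloor> = real_of_int (\<lfloor>d v\<rfloor> + ?m)" if "v \<in> pverts G" for v
    using that by (metis add.commute diff_add_cancel)
  then have *: "d' v = d v + of_int ?m" if "v \<in> pverts G" for v
    using pos(1)[OF that] that by (simp add: frac_def)
  have eq': "d' v = d v + of_int ?m" for v
    using *[of v] *[OF root] lift_off[OF d(1), of v] lift_off[OF d(2), of v] by (cases "v \<in> pverts G") auto
  show thesis by (rule that[OF pos(2)[OF root]]) (rule ext, rule eq')
qed

lemma liftD_real:
  assumes "d \<in> lift f" "(u, v) \<in> up f"
  shows "d v \<le> d u" "d u \<le> d v + 1"
  using liftD(1,2)[OF assms] by linarith+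

text \<open>Adjacent heights differ by at most 1, so all heights stay near that of the root and only
  a common translation can be unbounded. Summing turns the bounds at single vertices into a uniform
  one.\<close>

lemma lift_bounded:
  assumes "hom f"
  obtains B where "\<And>d v. d \<in> lift f \<Longrightarrow> \<bar>d v - d r\<bar> \<le> B"
proof -
  have "\<exists>B. \<forall>d\<in>lift f. \<bar>d v - d r\<bar> \<le> B" if "v \<in> pverts G" for v
    using that
  proof (rule conn[rotated 2])
    fix u v assume uv: "(u, v) \<in> parcs G" and "\<exists>B. \<forall>d\<in>lift f. \<bar>d u - d r\<bar> \<le> B"
    then obtain B where B: "\<forall>d\<in>lift f. \<bar>d u - d r\<bar> \<le> B" by blast
    have "\<bar>d v - d r\<bar> \<le> B + 1" if "d \<in> lift f" for d
      using homD[OF assms uv]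
    proof
      assume "(u, v) \<in> up f"
      from liftD_real[OF that this] bspec[OF B that] show ?thesis by linarith
    next
      assume "(v, u) \<in> up f"
      from liftD_real[OF that this] bspec[OF B that] show ?thesis by linarith
    qed
    then show "\<exists>B. \<forall>d\<in>lift f. \<bar>d v - d r\<bar> \<le> B" by blast
  qed auto
  then obtain B where B: "\<And>v d. v \<in> pverts G \<Longrightarrow> d \<in> lift f \<Longrightarrow> \<bar>d v - d r\<bar> \<le> B v"
    by metis
  have "\<bar>d v - d r\<bar> \<le> (\<Sum>v\<in>pverts G. \<bar>B v\<bar>)" if d: "d \<in> lift f" for d v
  proof (cases "v \<in> pverts G")
    case True
    then have "\<bar>B v\<bar> \<le> (\<Sum>v\<in>pverts G. \<bar>B v\<bar>)"
      using fin by (intro member_le_sum) auto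
    with B[OF True d] show ?thesis by linarith
  next
    case False
    then show ?thesis using lift_off[OF d] by (simp add: sum_nonneg)
  qed
  then show thesis by (rule that)
qed

section \<open>Change of the base homomorphism\<close>

lemma up_rebase:
  assumes f: "hom f" and e: "(\<lambda>v. of_int (e v)) \<in> lift f"
  shows "(u, v) \<in> up (\<lambda>v. f v + 2 * e v) \<longleftrightarrow> (u, v) \<in> up f \<and> e u = e v \<or> (v, u) \<in> up f \<and> e v = e u + 1"
proof
  have k2: "\<not> int k dvd 2" using k_dvd_small[of 2] by auto
  assume "(u, v) \<in> up (\<lambda>v. f v + 2 * e v)"
  then have uv: "(u, v) \<in> parcs G" and dvd: "int k dvd f v + 2 * e v - (f u + 2 * e u) - 1"
    by (auto simp: up_def)
  \<comment> \<open>Label differences change by \<open>2 * (e v - e u)\<close>: equal heights keep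
    the direction of an arc, a height difference of 1 reverses it. In each case the other
    alternative would make \<open>k\<close> divide 2.\<close>
  from homD[OF f uv] show "(u, v) \<in> up f \<and> e u = e v \<or> (v, u) \<in> up f \<and> e v = e u + 1"
  proof
    assume up: "(u, v) \<in> up f"
    then have "int k dvd f v - f u - 1" by (simp add: up_def)
    from dvd_diff[OF this dvd] have "e u \<noteq> e v + 1" using k2 by auto
    then show ?thesis using liftD(3,4)[OF e up] up by auto
  next
    assume up: "(v, u) \<in> up f"
    then have "int k dvd f u - f v - 1" by (simp add: up_def)
    from dvd_add[OF this dvd] have "e u = e v \<Longrightarrow> int k dvd - 2" by simp
    then have "e u \<noteq> e v" using k2 by (simp only: dvd_minus_iff) blast
    then show ?thesis using liftD(3,4)[OF e up] up by auto
  qed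
next
  assume "(u, v) \<in> up f \<and> e u = e v \<or> (v, u) \<in> up f \<and> e v = e u + 1"
  then show "(u, v) \<in> up (\<lambda>v. f v + 2 * e v)"
  proof
    assume "(v, u) \<in> up f \<and> e v = e u + 1"
    then have "(u, v) \<in> parcs G" "int k dvd - (f u - f v - 1)" "e v = e u + 1"
      using sym by (simp_all only: up_def dvd_minus_iff) auto
    then show ?thesis by (auto simp: up_def algebra_simps)
  qed (auto simp: up_def)
qed

text \<open>Any integral point of the lift can serve as the new base. On an arc that is reversed,
  the translation exchanges the two staircase inequalities, so the conditions match.\<close>

lemma lift_rebase:
  assumes f: "hom f" and e: "(\<lambda>v. of_int (e v)) \<in> lift f"
  shows "d \<in> lift (\<lambda>v. f v + 2 * e v) \<longleftrightarrow> (\<lambda>v. d v + of_int (e v)) \<in> lift f"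
proof -
  have off: "e v = e r" if "v \<notin> pverts G" for v
    using lift_off[OF e that] by simp
  have "(\<forall>u v. (u, v) \<in> up (\<lambda>v. f v + 2 * e v) \<longrightarrow> \<lceil>d v\<rceil> \<le> \<lfloor>d u\<rfloor> \<and> \<lceil>d u\<rceil> \<le> \<lfloor>d v\<rfloor> + 1) \<longleftrightarrow>
      (\<forall>u v. (u, v) \<in> up f \<longrightarrow> \<lceil>d v\<rceil> + e v \<le> \<lfloor>d u\<rfloor> + e u \<and> \<lceil>d u\<rceil> + e u \<le> \<lfloor>d v\<rfloor> + e v + 1)"
    (is "?L \<longleftrightarrow> ?R")
  proof
    assume L: ?L
    show ?R
    proof (intro allI impI)
      fix u v assume up: "(u, v) \<in> up f"
      consider "e u = e v" | "e u = e v + 1" using liftD(3,4)[OF e up] by fastforce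
      then show "\<lceil>d v\<rceil> + e v \<le> \<lfloor>d u\<rfloor> + e u \<and> \<lceil>d u\<rceil> + e u \<le> \<lfloor>d v\<rfloor> + e v + 1"
      proof cases
        case 1
        then show ?thesis using L up up_rebase[OF assms, of u v] by auto
      next
        case 2
        then show ?thesis using L up up_rebase[OF assms, of v u] by auto
      qed
    qed
  next
    assume ?R
    then show ?L unfolding up_rebase[OF assms] by fastforce
  qed
  then show ?thesis
    unfolding lift_def using off by (auto simp: case_prod_unfold)
qed

lemma component_rebase:
  assumes f: "hom f" and e: "(\<lambda>v. of_int (e v)) \<in> component f"
  shows "d \<in> component (\<lambda>v. f v + 2 * e v) \<longleftrightarrow> (\<lambda>v. d v + of_int (e v)) \<in> component f"
proof -
  let ?f = "\<lambda>v. f v + 2 * e v"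
  have eL: "(\<lambda>v. of_int (e v)) \<in> lift f" using e component_subset by blast
  have cont: "continuous_on UNIV (\<lambda>(d :: 'a \<Rightarrow> real) v. d v + c v)" for c
    by (intro continuous_on_coordinatewise_then_product continuous_on_add continuous_on_const
        continuous_on_product_coordinates)
  have "path_component (lift ?f) (\<lambda>_. 0) d \<longleftrightarrow>
      path_component (lift f) (\<lambda>v. of_int (e v)) (\<lambda>v. d v + of_int (e v))"
  proof
    assume "path_component (lift ?f) (\<lambda>_. 0) d"
    from path_component_map[OF this cont[of "\<lambda>v. of_int (e v)"], of "lift f"]
    show "path_component (lift f) (\<lambda>v. of_int (e v)) (\<lambda>v. d v + of_int (e v))"
      using lift_rebase[OF f eL] by simp
  next
    assume "path_component (lift f) (\<lambda>v. of_int (e v)) (\<lambda>v. d v + of_int (e v))"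
    from path_component_map[OF this cont[of "\<lambda>v. - of_int (e v)"], of "lift ?f"]
    show "path_component (lift ?f) (\<lambda>_. 0) d"
      using lift_rebase[OF f eL] by simp
  qed
  also have "\<dots> \<longleftrightarrow> (\<lambda>v. d v + of_int (e v)) \<in> component f"
    using e unfolding component_def
    by (metis mem_Collect_eq path_component_sym path_component_trans)
  finally show ?thesis by (simp add: component_def)
qed

lemma piece_rebase:
  assumes f: "hom f" and e: "(\<lambda>v. of_int (e v)) \<in> component f"
  shows "piece (\<lambda>v. f v + 2 * e v) = piece f"
proof -
  have proj: "proj (\<lambda>v. f v + 2 * e v) d = proj f (\<lambda>v. d v + of_int (e v))" for d
    unfolding proj_def by (simp add: pos_add_int)
  show ?thesis
    unfolding piece_def
  proof (intro set_eqI iffI)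
    fix x assume "x \<in> proj (\<lambda>v. f v + 2 * e v) ` component (\<lambda>v. f v + 2 * e v)"
    then show "x \<in> proj f ` component f"
      using component_rebase[OF assms] proj by auto
  next
    fix x assume "x \<in> proj f ` component f"
    then obtain d where d: "d \<in> component f" "x = proj f d" by blast
    then show "x \<in> proj (\<lambda>v. f v + 2 * e v) ` component (\<lambda>v. f v + 2 * e v)"
      using component_rebase[OF assms, of "\<lambda>v. d v - of_int (e v)"] proj[of "\<lambda>v. d v - of_int (e v)"]
      by (intro image_eqI[of _ _ "\<lambda>v. d v - of_int (e v)"]) auto
  qed
qed

lemma rep_cong:
  assumes "\<And>v. v \<in> pverts G \<Longrightarrow> int k dvd f v - g v"
  shows "proj f = proj g" "component f = component g"
proof -
  have "int k dvd f v - f u - 1 \<longleftrightarrow> int k dvd g v - g u - 1" if "(u, v) \<in> parcs G" for u v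
  proof -
    have "int k dvd (f v - g v) - (f u - g u)"
      using arcs[OF that] by (intro dvd_diff assms) auto
    moreover have "f v - f u - 1 = (g v - g u - 1) + ((f v - g v) - (f u - g u))" by simp
    ultimately show ?thesis by (metis dvd_add_left_iff)
  qed
  then have "up f = up g" by (auto simp: up_def)
  then show "component f = component g" by (simp add: component_def lift_def)
  show "proj f = proj g"
    unfolding proj_def by (intro ext) (auto simp: restrict_def pos_cong[OF assms])
qed

lemma piece_cong:
  assumes "\<And>v. v \<in> pverts G \<Longrightarrow> int k dvd f v - g v"
  shows "piece f = piece g"
  using rep_cong[OF assms] by (simp add: piece_def)

text \<open>Rounding down the heights of a common point yields the same homomorphism modulo
  \<open>k\<close> from both bases, and rebasing at it changes neither piece.\<close>

lemma piece_eqI: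
  assumes "hom f" "hom g" "x \<in> piece f" "x \<in> piece g"
  shows "piece f = piece g"
proof -
  obtain d d' where d: "d \<in> component f" "x = proj f d" and d': "d' \<in> component g" "x = proj g d'"
    using assms by (auto simp: piece_def)
  have "pos (f v) (d v) = pos (g v) (d' v)" if "v \<in> pverts G" for v
    using d(2) d'(2) that unfolding proj_def by (metis restrict_apply')
  then have "piece (\<lambda>v. f v + 2 * \<lfloor>d v\<rfloor>) = piece (\<lambda>v. g v + 2 * \<lfloor>d' v\<rfloor>)"
    by (intro piece_cong pos_eqD(2))
  then show ?thesis
    using piece_rebase[OF assms(1) component_floor[OF d(1)]] piece_rebase[OF assms(2) component_floor[OF d'(1)]]
    by simp
qed

lemma finite_pieces: "finite (piece ` Collect hom)"
proof -
  have "finite {g. \<forall>v. (v \<in> pverts G \<longrightarrow> g v \<in> {0..<int k}) \<and> (v \<notin> pverts G \<longrightarrow> g v = 0)}" (is "finite ?F")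
    using fin by (intro finite_set_of_finite_funs) auto
  moreover have "piece f \<in> piece ` ?F" for f
  proof (rule image_eqI)
    show "piece f = piece (\<lambda>v. if v \<in> pverts G then f v mod int k else 0)"
      by (intro piece_cong) (auto simp: minus_mod_eq_mult_div)
  qed (use k3 in auto)
  ultimately show ?thesis by (meson finite_surj image_subsetI)
qed

abbreviation amb :: "('a \<Rightarrow> nat \<Rightarrow> real) topology" where
  "amb \<equiv> product_topology (\<lambda>_. euclidean) (pverts G)"

lemma continuous_map_proj: "continuous_map (top_of_set S) amb (proj f)"
proof -
  have "continuous_on S (\<lambda>d. pos (f v) (d v))" for v
    by (intro continuous_on_coordinatewise_then_product
        continuous_on_compose2[OF continuous_on_pos continuous_on_subset[OF continuous_on_product_coordinates]]) auto
  then show ?thesis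
    by (auto simp: proj_def continuous_map_componentwise)
qed

lemma Hausdorff_amb: "Hausdorff_space (subtopology amb A)"
  by (intro Hausdorff_space_subtopology) (simp add: Hausdorff_space_product_topology)

text \<open>Heights are functions on the whole vertex type, possibly infinite, so compactness comes
  from Tychonoff's theorem, with the same interval for every coordinate.\<close>

lemma component_bounded_compact:
  assumes "M \<subseteq> component f" "closed M" "\<And>d v. d \<in> M \<Longrightarrow> d v \<in> {a..b}"
  shows "compact M"
proof -
  have "compactin (product_topology (\<lambda>_. euclidean) UNIV) (PiE UNIV (\<lambda>_::'a. {a..b::real}))"
    by (subst compactin_PiE) auto
  then have "compact (PiE UNIV (\<lambda>_::'a. {a..b::real}))"
    by (simp add: euclidean_product_topology)
  moreover have "M = PiE UNIV (\<lambda>_::'a. {a..b::real}) \<inter> M"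
    using assms(3) by auto
  ultimately show ?thesis using assms(2) by (metis compact_Int_closed)
qed

section \<open>The homotopy type of a piece\<close>

abbreviation piece_space :: "('a \<Rightarrow> int) \<Rightarrow> ('a \<Rightarrow> nat \<Rightarrow> real) topology" where
  "piece_space f \<equiv> subtopology amb (piece f)"

lemma topspace_piece: "topspace (piece_space f) = piece f"
  unfolding piece_def proj_def by auto

lemma continuous_map_proj_piece: "M \<subseteq> component f \<Longrightarrow> continuous_map (top_of_set M) (piece_space f) (proj f)"
  using continuous_map_proj by (auto simp: continuous_map_in_subtopology piece_def)

text \<open>Homotopies of a piece are built over a compact set \<open>M\<close> of heights that
  covers it; \<open>F\<close> may leave \<open>M\<close> as long as it stays in the
  component.\<close>

lemma homotopic_piece:
  fixes F :: "real \<times> ('a \<Rightarrow> real) \<Rightarrow> 'a \<Rightarrow> real"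
  assumes M: "M \<subseteq> component f" "compact M" "proj f ` M = piece f"
    and F: "continuous_on ({0..1} \<times> M) F" "F \<in> {0..1} \<times> M \<rightarrow> component f"
    and fib: "\<And>s x y. \<lbrakk>s \<in> {0..1}; x \<in> M; y \<in> M; proj f x = proj f y\<rbrakk> \<Longrightarrow> proj f (F (s, x)) = proj f (F (s, y))"
    and ends: "\<And>x. x \<in> M \<Longrightarrow> proj f (F (0, x)) = g (proj f x)" "\<And>x. x \<in> M \<Longrightarrow> proj f (F (1, x)) = h (proj f x)"
  shows "homotopic_with (\<lambda>_. True) (piece_space f) (piece_space f) g h"
proof (rule homotopic_with_quotient[where M = "top_of_set M" and p = "proj f" and F = "proj f \<circ> F"])
  have "continuous_map (top_of_set ({0..1} \<times> M)) (top_of_set (component f)) F"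
    using F by (auto simp: continuous_map_subtopology_eu)
  then have "continuous_map (top_of_set ({0..1} \<times> M)) (piece_space f) (proj f \<circ> F)"
    by (rule continuous_map_compose) (simp add: continuous_map_proj_piece)
  then show "continuous_map (prod_topology (top_of_set {0..1}) (top_of_set M)) (piece_space f) (proj f \<circ> F)"
    by (simp only: prod_topology_subtopology_eu)
  show "compact_space (top_of_set M)" using M(2) by (simp add: compact_space_subtopology)
  show "Hausdorff_space (piece_space f)" by (rule Hausdorff_amb)
  show "continuous_map (top_of_set M) (piece_space f) (proj f)" using M(1) by (rule continuous_map_proj_piece)
  show "proj f ` topspace (top_of_set M) = topspace (piece_space f)" unfolding topspace_piece using M(3) by simp
qed (auto intro: fib simp: ends)

lemma component_path:
  assumes "d \<in> component f" "d' \<in> component f"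
  obtains \<gamma> where "continuous_on {0..1} \<gamma>" "\<And>t. t \<in> {0..1} \<Longrightarrow> \<gamma> t \<in> component f" "\<gamma> 0 = d" "\<gamma> (1::real) = d'"
proof -
  have "path_connected (component f)"
    unfolding component_def by (rule path_connected_path_component)
  then obtain \<gamma> where "path \<gamma>" "path_image \<gamma> \<subseteq> component f" "pathstart \<gamma> = d" "pathfinish \<gamma> = d'"
    using assms unfolding path_connected_def by metis
  then show thesis
    by (intro that[of \<gamma>]) (auto simp: path_def path_image_def pathstart_def pathfinish_def)
qed

lemma component_upper_bound:
  assumes "finite S" "S \<subseteq> component f"
  obtains T where "T \<in> component f" "\<And>d v. d \<in> S \<Longrightarrow> d v \<le> T v"
proof -
  have "\<exists>T\<in>component f. \<forall>d\<in>S. \<forall>v. d v \<le> T v"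
    using assms
  proof (induction S)
    case empty
    then show ?case using component_0 by auto
  next
    case (insert d S)
    then obtain T where T: "T \<in> component f" "\<forall>d\<in>S. \<forall>v. d v \<le> T v" by auto
    then show ?case
      using insert.prems component_max[of d f T] by (intro bexI[of _ "\<lambda>v. max (d v) (T v)"]) (auto simp: le_max_iff_disj)
  qed
  then show thesis using that by blast
qed

lemma component_lower_bound:
  assumes "finite S" "S \<subseteq> component f"
  obtains T where "T \<in> component f" "\<And>d v. d \<in> S \<Longrightarrow> T v \<le> d v"
proof -
  have "\<exists>T\<in>component f. \<forall>d\<in>S. \<forall>v. T v \<le> d v"
    using assms
  proof (induction S)
    case empty
    then show ?case using component_0 by auto
  next
    case (insert d S)
    then obtain T where T: "T \<in> component f" "\<forall>d\<in>S. \<forall>v. T v \<le> d v" by auto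
    then show ?case
      using insert.prems component_min[of d f T] by (intro bexI[of _ "\<lambda>v. min (d v) (T v)"]) (auto simp: min_le_iff_disj)
  qed
  then show thesis using that by blast
qed

text \<open>Integral heights project to homomorphisms, with one corner at each vertex, and there are
  only finitely many of those.\<close>

lemma finite_integral_points:
  assumes inj: "inj_on (proj f) (component f)" and S: "S \<subseteq> component f" "\<And>d v. d \<in> S \<Longrightarrow> d v \<in> \<int>"
  shows "finite S"
proof (rule inj_on_finite[OF inj_on_subset[OF inj S(1)]])
  show "proj f ` S \<subseteq> PiE (pverts G) (\<lambda>_. (\<lambda>m w. of_bool (int w = m)) ` {0..<int k})"
  proof clarify
    fix d assume "d \<in> S"
    have "pos (f v) (d v) \<in> (\<lambda>m w. of_bool (int w = m)) ` {0..<int k}" for v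
    proof (rule image_eqI)
      have "frac (d v) = 0" using S(2)[OF \<open>d \<in> S\<close>, of v] by (simp add: frac_eq_0_iff)
      then show "pos (f v) (d v) = (\<lambda>w. of_bool (int w = (f v + 2 * \<lfloor>d v\<rfloor>) mod int k))"
        by (simp add: pos_def fun_eq_iff)
    qed (use k3 in auto)
    then show "proj f d \<in> PiE (pverts G) (\<lambda>_. (\<lambda>m w. of_bool (int w = m)) ` {0..<int k})"
      by (auto simp: proj_def)
  qed
  show "finite (PiE (pverts G) (\<lambda>_. (\<lambda>m w. of_bool (int w = m) :: real) ` {0..<int k}))"
    using fin by (intro finite_PiE) auto
qed

lemma piece_point:
  assumes f: "hom f" and no_period: "\<And>m. int k dvd 2 * m \<Longrightarrow> (\<lambda>_. of_int m) \<in> component f \<Longrightarrow> m = 0"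
  shows "piece_space f homotopy_equivalent_space top_of_set {0 :: complex}"
proof -
  have inj: "inj_on (proj f) (component f)"
  proof (rule inj_onI)
    fix x y assume xy: "x \<in> component f" "y \<in> component f" "proj f x = proj f y"
    obtain m where m: "int k dvd 2 * m" "y = (\<lambda>v. x v + of_int m)"
      by (rule proj_eqD[OF f _ _ xy(3)]) (use xy component_subset in auto)
    then have "m = 0" using no_period[OF m(1)] component_shift_minus[OF xy(1)] xy(2) by simp
    with m show "x = y" by simp
  qed
  \<comment> \<open>Every point lies below its rounding upwards, and there are only finitely many
    such roundings, so bounding these bounds the component. The lower bound \<open>L\<close> is
    obtained dually.\<close>
  obtain T where T: "T \<in> component f" "\<And>d v. d \<in> (\<lambda>d v. of_int \<lceil>d v\<rceil>) ` component f \<Longrightarrow> d v \<le> T v"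
    by (rule component_upper_bound[OF finite_integral_points[OF inj, of "(\<lambda>d v. of_int \<lceil>d v\<rceil>) ` component f"]])
       (auto simp: component_ceiling)
  obtain L where L: "L \<in> component f" "\<And>d v. d \<in> (\<lambda>d v. of_int \<lfloor>d v\<rfloor>) ` component f \<Longrightarrow> L v \<le> d v"
    by (rule component_lower_bound[OF finite_integral_points[OF inj, of "(\<lambda>d v. of_int \<lfloor>d v\<rfloor>) ` component f"]])
       (auto simp: component_floor)
  have T': "d v \<le> T v" and L': "L v \<le> d v" if "d \<in> component f" for d v
    using T(2)[OF imageI[OF that], of v] L(2)[OF imageI[OF that], of v] by linarith+
  obtain B where B: "\<And>d v. d \<in> lift f \<Longrightarrow> \<bar>d v - d r\<bar> \<le> B"
    using lift_bounded[OF f] by blast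
  \<comment> \<open>The compactness criterion wants bounds independent of \<open>v\<close>, hence
    the detour through the root.\<close>
  have "compact (component f)"
  proof (rule component_bounded_compact[OF subset_refl closed_component])
    fix d v assume d: "d \<in> component f"
    then show "d v \<in> {L r - B..T r + B}"
      using B[of d v] component_subset T'[OF d, of r] L'[OF d, of r] by fastforce
  qed
  obtain \<gamma> where \<gamma>: "continuous_on {0..1} \<gamma>" "\<And>t. t \<in> {0..1} \<Longrightarrow> \<gamma> t \<in> component f" "\<gamma> 0 = T" "\<gamma> (1::real) = L"
    by (rule component_path[OF T(1) L(1)]) blast
  have "homotopic_with (\<lambda>_. True) (piece_space f) (piece_space f) id (\<lambda>_. proj f L)"
  proof (rule homotopic_piece[where M = "component f" and F = "\<lambda>(s, x) v. min (x v) (\<gamma> s v)"])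
    have "continuous_on ({0..1} \<times> component f) (\<lambda>p. \<gamma> (fst p) v)" for v
      by (rule continuous_on_compose2[OF continuous_on_product_then_coordinatewise[OF \<gamma>(1)]])
         (auto intro: continuous_on_fst)
    then show "continuous_on ({0..1} \<times> component f) (\<lambda>(s, x) v. min (x v) (\<gamma> s v))"
      unfolding case_prod_unfold
      by (intro continuous_on_coordinatewise_then_product continuous_on_min
          continuous_on_product_then_coordinatewise[OF continuous_on_snd] continuous_on_id)
    show "(\<lambda>(s, x) v. min (x v) (\<gamma> s v)) \<in> {0..1} \<times> component f \<rightarrow> component f"
      using component_min \<gamma>(2) by auto
    show "proj f (case (s, x) of (s, x) \<Rightarrow> \<lambda>v. min (x v) (\<gamma> s v)) =
        proj f (case (s, y) of (s, x) \<Rightarrow> \<lambda>v. min (x v) (\<gamma> s v))"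
      if "x \<in> component f" "y \<in> component f" "proj f x = proj f y" for s x y
      using inj_onD[OF inj that(3,1,2)] by simp
  qed (use T' L' \<gamma>(3,4) in \<open>auto simp: piece_def min_absorb1 min_absorb2 \<open>compact (component f)\<close>\<close>)
  then have "contractible_space (piece_space f)"
    unfolding contractible_space_def by blast
  moreover have "piece f \<noteq> {}" using component_0 by (auto simp: piece_def)
  ultimately show ?thesis
    by (intro contractible_homotopy_equivalent_point) (simp_all only: topspace_piece not_False_eq_True)
qed

text \<open>With a least period \<open>c\<close>, a path from \<open>0\<close> to the constant \<open>c\<close> extends equivariantly to a line
  \<open>\<gamma>\<close>; the meet with a far translate of \<open>\<gamma>\<close> is \<open>x\<close> itself or a point of \<open>\<gamma>\<close>, depending on the
  direction of the translation, and equivariance makes this homotopy descend to the piece.\<close>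

lemma piece_circle:
  assumes f: "hom f" and c: "0 < c" "int k dvd 2 * c" "(\<lambda>_. of_int c) \<in> component f"
    and least: "\<And>m. int k dvd 2 * m \<Longrightarrow> (\<lambda>_. of_int m) \<in> component f \<Longrightarrow> c dvd m"
  shows "piece_space f homotopy_equivalent_space top_of_set (sphere 0 1 :: complex set)"
proof -
  have c_mult: "(\<lambda>_. of_int (c * n)) \<in> component f" for n
  proof -
    have nat: "(\<lambda>_. of_int (c * int n)) \<in> component f" for n
    proof (induction n)
      case 0
      then show ?case using component_0 by simp
    next
      case (Suc n)
      from component_shift[OF this c(3)] show ?case by (simp add: algebra_simps)
    qed
    show ?thesis
    proof (cases "0 \<le> n")
      case True
      with nat[of "nat n"] show ?thesis by simp
    next
      case False
      \<comment> \<open>For negative \<open>n\<close>, translation by \<open>c * n\<close> takes the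
        opposite multiple back to the zero function.\<close>
      have "(\<lambda>_. of_int (c * int (nat (- n))) + of_int (c * n)) \<in> component f"
        using False component_0 by simp
      from component_shift_minus[OF nat this] show ?thesis .
    qed
  qed
  have shift: "(\<lambda>v. d v + of_int (c * n)) \<in> component f" if "d \<in> component f" for d n
    using component_shift[OF that c_mult] .
  have proj_c: "proj f (\<lambda>v. d v + of_int (c * n)) = proj f d" for d n
    using c(2) by (intro proj_shift) (simp add: dvd_mult2 flip: mult.assoc)
  obtain \<gamma>0 where \<gamma>0: "continuous_on {0..1} \<gamma>0" "\<And>t. t \<in> {0..1} \<Longrightarrow> \<gamma>0 t \<in> component f"
      "\<gamma>0 0 = (\<lambda>_. 0)" "\<gamma>0 (1::real) = (\<lambda>_. of_int c)"
    by (rule component_path[OF component_0 c(3)]) blast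
  \<comment> \<open>The path \<open>\<gamma>0\<close> is known only on the unit interval, whereas
    gluing needs each \<open>g n\<close> to be continuous on the whole line. The summand
    \<open>c * n\<close> in \<open>g\<close> makes consecutive copies fit, as
    \<open>\<gamma>0\<close> leads from \<open>0\<close> to \<open>c\<close>.\<close>
  define clamp where "clamp t = min 1 (max 0 t)" for t :: real
  have clamp: "clamp t \<in> {0..1}" "clamp 0 = 0" "clamp 1 = 1" for t by (auto simp: clamp_def)
  define g where "g n t v = \<gamma>0 (clamp (t - of_int n)) v + of_int (c * n)" for n t v
  define \<gamma> where "\<gamma> t = g \<lfloor>t\<rfloor> t" for t
  have \<gamma>_cont: "continuous_on UNIV \<gamma>"
    unfolding \<gamma>_def
  proof (rule continuous_floor_glue)
    have "continuous_on UNIV (\<lambda>t. clamp (t - of_int n))" for n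
      unfolding clamp_def
      by (intro continuous_on_min continuous_on_max continuous_on_diff continuous_on_const continuous_on_id)
    then have "continuous_on UNIV (\<lambda>t. \<gamma>0 (clamp (t - of_int n)))" for n
      by (rule continuous_on_compose2[OF \<gamma>0(1)]) (use clamp(1) in blast)
    then have "continuous_on UNIV (\<lambda>t. \<gamma>0 (clamp (t - of_int n)) v)" for n v
      by (rule continuous_on_product_then_coordinatewise)
    then show "continuous_on UNIV (g n)" for n
      unfolding g_def
      by (intro continuous_on_coordinatewise_then_product continuous_on_add continuous_on_const)
    show "g n (of_int n + 1) = g (n + 1) (of_int n + 1)" for n
      by (simp add: g_def clamp \<gamma>0 fun_eq_iff algebra_simps)
  qed
  have \<gamma>_mem: "\<gamma> t \<in> component f" for t
    unfolding \<gamma>_def g_def using shift[OF \<gamma>0(2)[OF clamp(1)]] .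
  have \<gamma>_shift: "\<gamma> (t + of_int j) = (\<lambda>v. \<gamma> t v + of_int (c * j))" for t j
    by (simp add: \<gamma>_def g_def fun_eq_iff algebra_simps)
  \<comment> \<open>The height of the root in units of the period: an equivariant function to the
    line whose class modulo 1 is the circle coordinate.\<close>
  define \<tau> :: "('a \<Rightarrow> real) \<Rightarrow> real" where "\<tau> d = d r / of_int c" for d
  have \<tau>_shift: "\<tau> (\<lambda>v. d v + of_int (c * j)) = \<tau> d + of_int j" for d j
    using c(1) by (simp add: \<tau>_def field_simps)
  have fibre: "\<exists>j. y = (\<lambda>v. x v + of_int (c * j))"
    if xy: "x \<in> component f" "y \<in> component f" "proj f x = proj f y" for x y
  proof -
    obtain m where m: "int k dvd 2 * m" "y = (\<lambda>v. x v + of_int m)"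
      by (rule proj_eqD[OF f _ _ xy(3)]) (use xy component_subset in auto)
    then have "c dvd m" using least[OF m(1)] component_shift_minus[OF xy(1)] xy(2) by simp
    with m(2) show ?thesis by (auto elim!: dvdE)
  qed
  \<comment> \<open>A compact set that meets every orbit: translating \<open>d\<close> by
    \<open>- \<lfloor>\<tau> d\<rfloor>\<close> periods brings it here.\<close>
  define M where "M = component f \<inter> {d. 0 \<le> d r \<and> d r \<le> of_int c}"
  have M_comp: "M \<subseteq> component f" by (simp add: M_def)
  obtain B where B: "\<And>d v. d \<in> lift f \<Longrightarrow> \<bar>d v - d r\<bar> \<le> B"
    using lift_bounded[OF f] by blast
  have B': "\<bar>d v - d r\<bar> \<le> B" if "d \<in> component f" for d v
    using B that component_subset by blast
  have "closed {d :: 'a \<Rightarrow> real. 0 \<le> d r \<and> d r \<le> of_int c}"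
    by (intro closed_Collect_conj closed_Collect_le continuous_on_const continuous_on_product_coordinates)
  then have M_compact: "compact M"
  proof (intro component_bounded_compact[of M f "- B" "of_int c + B"] M_comp)
    show "d v \<in> {- B..of_int c + B}" if "d \<in> M" for d v
      using that B'[of d v] by (auto simp: M_def)
  qed (simp add: M_def closed_component closed_Int)
  have M_repr: "\<exists>x\<in>M. \<exists>n. x = (\<lambda>v. d v + of_int (c * n))" if "d \<in> component f" for d
  proof -
    let ?n = "- \<lfloor>\<tau> d\<rfloor>" and ?x = "\<lambda>v. d v + of_int (c * - \<lfloor>\<tau> d\<rfloor>)"
    have "0 \<le> \<tau> ?x" "\<tau> ?x \<le> 1" unfolding \<tau>_shift by simp_all linarith
    then have "0 \<le> ?x r" "?x r \<le> of_int c"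
      using c(1) unfolding \<tau>_def by (auto simp: zero_le_divide_iff divide_le_eq)
    then have "?x \<in> M" using shift[OF that, of ?n] by (simp add: M_def)
    then show ?thesis by blast
  qed
  have M_proj: "proj f ` M = piece f"
  proof
    show "piece f \<subseteq> proj f ` M"
    proof
      fix p assume "p \<in> piece f"
      then obtain d where d: "d \<in> component f" "p = proj f d" by (auto simp: piece_def)
      then obtain x n where "x \<in> M" "x = (\<lambda>v. d v + of_int (c * n))" using M_repr by blast
      then have "p = proj f x" "x \<in> M" using d(2) proj_c[of d n] by simp_all
      then show "p \<in> proj f ` M" by (rule image_eqI)
    qed
  qed (use M_comp in \<open>auto simp: piece_def\<close>)
  have "continuous_on {0..1} (\<lambda>t. \<gamma> t r)"
    using continuous_on_product_then_coordinatewise[OF \<gamma>_cont] continuous_on_subset by blast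
  then have "compact ((\<lambda>t. \<gamma> t r) ` {0..1})" by (rule compact_continuous_image) simp
  then obtain B'' where B'': "\<And>t. t \<in> {0..1} \<Longrightarrow> \<bar>\<gamma> t r\<bar> \<le> B''"
    using compact_imp_bounded bounded_real by (metis (no_types, lifting) imageI)
  \<comment> \<open>Coordinates of points of \<open>M\<close> lie between \<open>- B\<close> and
    \<open>c + B\<close>, those of \<open>\<gamma> (\<tau> x)\<close> within \<open>B + B''\<close>
    of zero. A translation by \<open>c + 2 * B + B''\<close> puts the line above or below
    \<open>x\<close>; as \<open>c\<close> is at least 1, that many periods suffice.\<close>
  define N where "N = \<lceil>of_int c + 2 * B + B''\<rceil>"
  have cN: "of_int c + 2 * B + B'' \<le> of_int (c * N)"
  proof -
    have "0 \<le> B''" using B''[of 0] by auto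
    moreover have "0 \<le> B" using B[OF lift_0] by simp
    ultimately have "0 \<le> N" unfolding N_def using c(1) by simp
    then have "N \<le> c * N" using c(1) mult_right_mono[of 1 c N] by simp
    then show ?thesis unfolding N_def by linarith
  qed
  have M_bounds: "x v \<le> \<gamma> (\<tau> x + of_int N) v" "\<gamma> (\<tau> x - of_int N) v \<le> x v" if "x \<in> M" for x v
  proof -
    have "\<tau> x \<in> {0..1}" using that c(1) by (auto simp: M_def \<tau>_def)
    then have "\<bar>\<gamma> (\<tau> x) v\<bar> \<le> B + B''"
      using B'[OF \<gamma>_mem, of "\<tau> x" v] B''[of "\<tau> x"] by linarith
    moreover have "0 \<le> x r" "x r \<le> of_int c" "\<bar>x v - x r\<bar> \<le> B"
      using that B'[of x v] by (auto simp: M_def)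
    ultimately show "x v \<le> \<gamma> (\<tau> x + of_int N) v" "\<gamma> (\<tau> x - of_int N) v \<le> x v"
      using cN \<gamma>_shift[of "\<tau> x" N] \<gamma>_shift[of "\<tau> x" "- N"] by auto
  qed
  have \<tau>_cont: "continuous_on S \<tau>" for S
    unfolding \<tau>_def using c(1)
    by (intro continuous_on_divide continuous_on_const
        continuous_on_subset[OF continuous_on_product_coordinates]) auto
  \<comment> \<open>The map \<open>q\<close> reads off the phase modulo 1; its inverse up to
    homotopy, \<open>h\<close>, runs once along the projected line.\<close>
  obtain q where q: "continuous_map (piece_space f) (top_of_set (sphere 0 1 :: complex set)) q"
      "\<And>x. x \<in> M \<Longrightarrow> q (proj f x) = cis (2 * pi * \<tau> x)"
  proof (rule continuous_map_quotient[where M = "top_of_set M" and A = "piece_space f" and p = "proj f"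
        and Y = "top_of_set (sphere 0 1 :: complex set)" and F = "\<lambda>x. cis (2 * pi * \<tau> x)"])
    show "continuous_map (top_of_set M) (top_of_set (sphere 0 1)) (\<lambda>x. cis (2 * pi * \<tau> x))"
      by (auto intro!: continuous_on_cis continuous_on_mult continuous_on_const \<tau>_cont)
    show "cis (2 * pi * \<tau> x) = cis (2 * pi * \<tau> y)"
      if "x \<in> topspace (top_of_set M)" "y \<in> topspace (top_of_set M)" "proj f x = proj f y" for x y
    proof -
      have "x \<in> component f" "y \<in> component f" using that M_comp by auto
      with fibre that(3) obtain j where "y = (\<lambda>v. x v + of_int (c * j))" by blast
      then show ?thesis unfolding cis_2pi_eq_iff using \<tau>_shift by auto
    qed
  qed (use M_compact M_proj in \<open>auto simp only: topspace_piece topspace_euclidean_subtopology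
        compact_space_subtopology compactin_euclidean_iff Hausdorff_amb
        intro!: continuous_map_proj_piece M_comp\<close>)
  \<comment> \<open>The points \<open>\<gamma> t\<close> need not lie in \<open>M\<close>, so the
    formula for \<open>q\<close> is extended by periodicity.\<close>
  have q_comp: "q (proj f d) = cis (2 * pi * \<tau> d)" if "d \<in> component f" for d
  proof -
    from M_repr[OF that] obtain x n where x: "x \<in> M" "x = (\<lambda>v. d v + of_int (c * n))" by blast
    have "q (proj f d) = q (proj f x)" using x(2) proj_c by simp
    also have "\<dots> = cis (2 * pi * \<tau> x)" by (rule q(2)[OF x(1)])
    also have "\<dots> = cis (2 * pi * \<tau> d)"
      unfolding cis_2pi_eq_iff x(2) \<tau>_shift by (intro exI[of _ "- n"]) simp
    finally show ?thesis .
  qed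
  let ?I = "top_of_set {0..1::real}" and ?e = "\<lambda>t::real. cis (2 * pi * t)"
  have e_cont: "continuous_map ?I (top_of_set (sphere 0 1)) ?e"
    by (auto intro!: continuous_on_cis continuous_intros)
  have e_image: "?e ` topspace ?I = topspace (top_of_set (sphere 0 1))"
    using cis_2pi_image by simp
  have I_compact: "compact_space ?I" by (simp add: compact_space_subtopology)
  have S_Hausdorff: "Hausdorff_space (top_of_set (sphere 0 1 :: complex set))"
    by (simp add: Hausdorff_space_subtopology)
  obtain h where h: "continuous_map (top_of_set (sphere 0 1 :: complex set)) (piece_space f) h"
      "\<And>t. t \<in> topspace ?I \<Longrightarrow> h (?e t) = proj f (\<gamma> t)"
  proof (rule continuous_map_quotient[OF I_compact S_Hausdorff e_cont e_image,
        where Y = "piece_space f" and F = "\<lambda>t. proj f (\<gamma> t)"])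
    have "continuous_map ?I (top_of_set (component f)) \<gamma>"
      using continuous_on_subset[OF \<gamma>_cont, of "{0..1}"] \<gamma>_mem by auto
    then have "continuous_map ?I (piece_space f) (proj f \<circ> \<gamma>)"
      by (rule continuous_map_compose) (simp add: continuous_map_proj_piece)
    then show "continuous_map ?I (piece_space f) (\<lambda>t. proj f (\<gamma> t))" by (simp add: comp_def)
    show "proj f (\<gamma> s) = proj f (\<gamma> t)" if "?e s = ?e t" for s t
      using that unfolding cis_2pi_eq_iff using \<gamma>_shift proj_c by auto
  qed blast
  have h_all: "h (?e t) = proj f (\<gamma> t)" for t
  proof -
    have "?e (frac t) = ?e t"
      unfolding cis_2pi_eq_iff frac_def by (intro exI[of _ "\<lfloor>t\<rfloor>"]) simp
    moreover have "h (?e (frac t)) = proj f (\<gamma> (frac t))"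
      by (rule h(2)) (simp add: frac_lt_1 less_imp_le)
    moreover have "\<gamma> t = (\<lambda>v. \<gamma> (frac t) v + of_int (c * \<lfloor>t\<rfloor>))"
      using \<gamma>_shift[of "frac t" "\<lfloor>t\<rfloor>"] by (simp add: frac_def)
    ultimately show ?thesis using proj_c by simp
  qed
  \<comment> \<open>Centring the parameter at \<open>\<tau> x\<close> makes the formula commute with
    translations. At the end it gives \<open>\<gamma> (\<tau> x - N)\<close>, which has the same
    projection as \<open>\<gamma> (\<tau> x)\<close>, namely
    \<open>h (q (proj f x))\<close>.\<close>
  have "homotopic_with (\<lambda>_. True) (piece_space f) (piece_space f) id (h \<circ> q)"
  proof (rule homotopic_piece[OF M_comp M_compact M_proj,
        where F = "\<lambda>(s, x) v. min (x v) (\<gamma> (\<tau> x + of_int N - 2 * of_int N * s) v)"])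
    have "continuous_on ({0..1} \<times> M) (\<lambda>p. \<tau> (snd p) + of_int N - 2 * of_int N * fst p)"
      by (intro continuous_intros continuous_on_compose2[OF \<tau>_cont continuous_on_snd]) auto
    then have "continuous_on ({0..1} \<times> M) (\<lambda>p. \<gamma> (\<tau> (snd p) + of_int N - 2 * of_int N * fst p) v)" for v
      by (rule continuous_on_compose2[OF continuous_on_product_then_coordinatewise[OF \<gamma>_cont]]) auto
    then show "continuous_on ({0..1} \<times> M) (\<lambda>(s, x) v. min (x v) (\<gamma> (\<tau> x + of_int N - 2 * of_int N * s) v))"
      unfolding case_prod_unfold
      by (intro continuous_on_coordinatewise_then_product continuous_on_min
          continuous_on_product_then_coordinatewise[OF continuous_on_snd] continuous_on_id)
    show "(\<lambda>(s, x) v. min (x v) (\<gamma> (\<tau> x + of_int N - 2 * of_int N * s) v)) \<in> {0..1} \<times> M \<rightarrow> component f"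
      using component_min \<gamma>_mem M_comp by auto
  next
    fix s x y assume xy: "x \<in> M" "y \<in> M" "proj f x = proj f y"
    then obtain j where j: "y = (\<lambda>v. x v + of_int (c * j))" using fibre M_comp by blast
    have "(\<lambda>v. min (y v) (\<gamma> (\<tau> y + of_int N - 2 * of_int N * s) v)) =
        (\<lambda>v. min (x v) (\<gamma> (\<tau> x + of_int N - 2 * of_int N * s) v) + of_int (c * j))"
    proof -
      have "\<tau> y + of_int N - 2 * of_int N * s = (\<tau> x + of_int N - 2 * of_int N * s) + of_int j"
        unfolding j \<tau>_shift by simp
      then have "\<gamma> (\<tau> y + of_int N - 2 * of_int N * s) =
          (\<lambda>v. \<gamma> (\<tau> x + of_int N - 2 * of_int N * s) v + of_int (c * j))"
        by (simp only: \<gamma>_shift)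
      then show ?thesis by (simp only: j min_add_distrib_left)
    qed
    then show "proj f (case (s, x) of (s, x) \<Rightarrow> \<lambda>v. min (x v) (\<gamma> (\<tau> x + of_int N - 2 * of_int N * s) v)) =
        proj f (case (s, y) of (s, x) \<Rightarrow> \<lambda>v. min (x v) (\<gamma> (\<tau> x + of_int N - 2 * of_int N * s) v))"
      using proj_c by simp
  next
    fix x assume x: "x \<in> M"
    then show "proj f (case (0, x) of (s, x) \<Rightarrow> \<lambda>v. min (x v) (\<gamma> (\<tau> x + of_int N - 2 * of_int N * s) v)) = id (proj f x)"
      using M_bounds(1)[OF x] by (simp add: min_absorb1)
    have "proj f (\<lambda>v. min (x v) (\<gamma> (\<tau> x - of_int N) v)) = proj f (\<gamma> (\<tau> x - of_int N))"
      using M_bounds(2)[OF x] by (simp add: min_absorb2)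
    also have "\<dots> = proj f (\<gamma> (\<tau> x))"
      using \<gamma>_shift[of "\<tau> x" "- N"] proj_c[of "\<gamma> (\<tau> x)" "- N"] by simp
    also have "\<dots> = (h \<circ> q) (proj f x)"
      using q(2)[OF x] h_all by simp
    finally show "proj f (case (1, x) of (s, x) \<Rightarrow> \<lambda>v. min (x v) (\<gamma> (\<tau> x + of_int N - 2 * of_int N * s) v)) =
        (h \<circ> q) (proj f x)"
      by (simp add: algebra_simps)
  qed
  then have hq: "homotopic_with (\<lambda>_. True) (piece_space f) (piece_space f) (h \<circ> q) id"
    by (rule homotopic_with_symD)
  \<comment> \<open>Both \<open>\<tau> (\<gamma> t)\<close> and \<open>t\<close> grow by 1 when
    \<open>t\<close> does, so the straight line between them is compatible with passing to the
    circle.\<close>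
  have qh: "homotopic_with (\<lambda>_. True) (top_of_set (sphere 0 1)) (top_of_set (sphere 0 1)) (q \<circ> h) id"
  proof (rule homotopic_with_quotient[OF I_compact S_Hausdorff e_cont e_image,
        where F = "\<lambda>(s, t). cis (2 * pi * ((1 - s) * \<tau> (\<gamma> t) + s * t))"])
    have "continuous_on ({0..1} \<times> {0..1}) (\<lambda>p::real\<times>real. \<tau> (\<gamma> (snd p)))"
      by (rule continuous_on_compose2[OF \<tau>_cont continuous_on_compose2[OF \<gamma>_cont]])
         (auto intro: continuous_on_snd)
    then have "continuous_on ({0..1} \<times> {0..1}) (\<lambda>(s, t). cis (2 * pi * ((1 - s) * \<tau> (\<gamma> t) + s * t)))"
      unfolding case_prod_unfold by (intro continuous_on_cis continuous_intros)
    then show "continuous_map (prod_topology ?I ?I) (top_of_set (sphere 0 1))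
        (\<lambda>(s, t). cis (2 * pi * ((1 - s) * \<tau> (\<gamma> t) + s * t)))"
      by (auto simp: prod_topology_subtopology_eu)
  next
    fix s x y :: real assume "?e x = ?e y"
    then obtain j where j: "y = x + of_int j" unfolding cis_2pi_eq_iff by blast
    have "(1 - s) * \<tau> (\<gamma> y) + s * y = ((1 - s) * \<tau> (\<gamma> x) + s * x) + of_int j"
      unfolding j \<gamma>_shift \<tau>_shift by (simp add: algebra_simps)
    then have "cis (2 * pi * ((1 - s) * \<tau> (\<gamma> x) + s * x)) = cis (2 * pi * ((1 - s) * \<tau> (\<gamma> y) + s * y))"
      unfolding cis_2pi_eq_iff by blast
    then show "(case (s, x) of (s, t) \<Rightarrow> cis (2 * pi * ((1 - s) * \<tau> (\<gamma> t) + s * t))) =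
        (case (s, y) of (s, t) \<Rightarrow> cis (2 * pi * ((1 - s) * \<tau> (\<gamma> t) + s * t)))" by simp
  qed (use h_all q_comp \<gamma>_mem in auto)
  show ?thesis
    unfolding homotopy_equivalent_space_def
    by (intro exI conjI) (rule q(1) h(1) hq qh)+
qed

text \<open>The periods form a subgroup of the integers; if it is nontrivial, its least positive
  element divides all others and serves as \<open>c\<close>.\<close>

lemma piece_homotopy_type:
  assumes f: "hom f"
  shows "\<exists>Y\<in>{top_of_set {0::complex}, top_of_set (sphere 0 1)}. piece_space f homotopy_equivalent_space Y"
proof (cases "\<exists>m. m \<noteq> 0 \<and> int k dvd 2 * m \<and> (\<lambda>_. of_int m) \<in> component f")
  case False
  then show ?thesis using piece_point[OF f] by blast
next
  case True
  define P where "P m \<longleftrightarrow> int k dvd 2 * m \<and> (\<lambda>_. of_int m) \<in> component f" for m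
  have diff: "P (a - b)" if "P a" "P b" for a b
  proof -
    have "int k dvd 2 * (a - b)" using that by (auto simp: P_def algebra_simps)
    moreover have "(\<lambda>_. of_int b + of_int (a - b)) \<in> component f" using that by (simp add: P_def)
    ultimately show ?thesis using that component_shift_minus[of "\<lambda>_. of_int b" f "a - b"] by (simp add: P_def)
  qed
  have P0: "P 0" using component_0 by (simp add: P_def)
  have neg: "P (- a)" if "P a" for a using diff[OF P0 that] by simp
  have add: "P (a + b)" if "P a" "P b" for a b using diff[OF that(1) neg[OF that(2)]] by simp
  obtain m where m: "m \<noteq> 0" "P m" using True by (auto simp: P_def)
  then have ex: "\<exists>n::nat. 0 < n \<and> P (int n)"
    using neg[of m] by (intro exI[of _ "nat \<bar>m\<bar>"]) (auto simp: abs_if)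
  define n where "n = (LEAST n::nat. 0 < n \<and> P (int n))"
  have n: "0 < n" "P (int n)" using LeastI_ex[OF ex] by (simp_all add: n_def)
  have min: "n \<le> n'" if "0 < n'" "P (int n')" for n'
    unfolding n_def using that by (intro Least_le) simp
  have "int n dvd a" if "P a" for a
  proof -
    have mult: "P (int n * int j)" for j :: nat
      by (induction j) (use P0 add n(2) in \<open>auto simp: algebra_simps\<close>)
    have "P (int n * i)" for i
      using mult[of "nat i"] neg[OF mult[of "nat (- i)"]] by (cases "0 \<le> i") auto
    then have "P (a - int n * (a div int n))" using that diff by blast
    then have "P (int (nat (a mod int n)))" using n(1) by (simp add: minus_mult_div_eq_mod)
    moreover have "nat (a mod int n) < n" using n(1) by (simp add: nat_less_iff)
    ultimately have "nat (a mod int n) = 0" using min[of "nat (a mod int n)"] by fastforce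
    then have "a mod int n = 0" using n(1) pos_mod_sign[of "int n" a] by linarith
    then show ?thesis by (rule mod_0_imp_dvd)
  qed
  then show ?thesis
    using piece_circle[OF f, of "int n"] n by (auto simp: P_def)
qed

section \<open>The decomposition into pieces\<close>

lemma k_pos: "0 < k" using k3 by simp

lemma pos_in_simplex:
  "pos a y \<in> simplex_on ((\<lambda>n. nat ((a + 2 * n) mod int k)) ` {\<lfloor>y\<rfloor>, \<lceil>y\<rceil>})"
proof -
  let ?A = "(a + 2 * \<lfloor>y\<rfloor>) mod int k" and ?B = "(a + 2 * \<lfloor>y\<rfloor> + 2) mod int k"
  have k0: "0 \<le> ?A" "0 \<le> ?B" using k3 by simp_all
  have ne: "?A \<noteq> ?B" using k_dvd_small[of "-2"] by (auto simp: mod_eq_dvd_iff)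
  have eqn: "int w = m \<longleftrightarrow> w = nat m" if "0 \<le> m" for w m using that by auto
  have pos: "pos a y w = (1 - frac y) * of_bool (w = nat ?A) + frac y * of_bool (w = nat ?B)" for w
    unfolding pos_def eqn[OF k0(1)] eqn[OF k0(2)] ..
  show ?thesis
  proof (cases "frac y = 0")
    case True
    then have "\<lceil>y\<rceil> = \<lfloor>y\<rfloor>" by (metis Ints_cases ceiling_of_int floor_of_int frac_eq_0_iff)
    moreover have "pos a y w = of_bool (w = nat ?A)" for w unfolding pos True by simp
    ultimately show ?thesis by (simp add: simplex_on_def)
  next
    case False
    then have "y \<notin> \<int>" by (simp add: frac_eq_0_iff)
    then have "\<lceil>y\<rceil> = \<lfloor>y\<rfloor> + 1" by (metis Ints_of_int ceiling_altdef)
    then have S: "(\<lambda>n. nat ((a + 2 * n) mod int k)) ` {\<lfloor>y\<rfloor>, \<lceil>y\<rceil>} = {nat ?A, nat ?B}"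
      by (simp add: algebra_simps)
    have ne': "nat ?A \<noteq> nat ?B" using ne k0 by (simp only: eq_nat_nat_iff not_False_eq_True)
    then have "sum (pos a y) {nat ?A, nat ?B} = 1" by (simp add: pos)
    moreover have "0 \<le> pos a y w" for w
      unfolding pos using frac_lt_1[of y] by (intro add_nonneg_nonneg mult_nonneg_nonneg) auto
    moreover have "pos a y w = 0" if "w \<notin> {nat ?A, nat ?B}" for w
      using that by (simp add: pos)
    ultimately show ?thesis unfolding S simplex_on_def by blast
  qed
qed

text \<open>The cell takes at \<open>v\<close> the labels for the floor and the ceiling of
  \<open>d v\<close>. The staircase conditions say that, along an up arc, any roundings of the two
  heights differ by 0 or 1, which keeps the labels adjacent.\<close>

lemma proj_in_hom_complex:
  assumes f: "hom f" and d: "d \<in> lift f"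
  shows "proj f d \<in> topspace (hom_complex G (cycle_graph k))"
proof -
  let ?\<eta> = "\<lambda>v\<in>pverts G. (\<lambda>n. nat ((f v + 2 * n) mod int k)) ` {\<lfloor>d v\<rfloor>, \<lceil>d v\<rceil>}"
  have adj: "int k dvd (f v + 2 * b) - (f u + 2 * a) - 1 \<or> int k dvd (f v + 2 * b) - (f u + 2 * a) + 1"
    if uv: "(u, v) \<in> parcs G" and ab: "a \<in> {\<lfloor>d u\<rfloor>, \<lceil>d u\<rceil>}" "b \<in> {\<lfloor>d v\<rfloor>, \<lceil>d v\<rceil>}" for u v a b
  proof -
    have ab': "\<lfloor>d u\<rfloor> \<le> a" "a \<le> \<lceil>d u\<rceil>" "\<lfloor>d v\<rfloor> \<le> b" "b \<le> \<lceil>d v\<rceil>"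
      using ab by auto
    from homD[OF f uv] show ?thesis
    proof
      assume up: "(u, v) \<in> up f"
      have "b \<le> a" "a \<le> b + 1"
        using liftD(1,2)[OF d up] ab' by linarith+
      then have "a = b \<or> a = b + 1" by linarith
      moreover have "int k dvd f v - f u - 1" using up by (simp add: up_def)
      ultimately show ?thesis by (auto simp: algebra_simps)
    next
      assume up: "(v, u) \<in> up f"
      have "a \<le> b" "b \<le> a + 1"
        using liftD(1,2)[OF d up] ab' by linarith+
      then have "b = a \<or> b = a + 1" by linarith
      moreover have "int k dvd f v - f u + 1"
        using up dvd_minus_iff[of "int k" "f u - f v - 1"] by (simp add: up_def algebra_simps)
      ultimately show ?thesis by (auto simp: algebra_simps)
    qed
  qed
  have cell: "?\<eta> \<in> hom_cells G (cycle_graph k)"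
    unfolding hom_cells_def
  proof (intro CollectI conjI)
    show "?\<eta> \<in> pverts G \<rightarrow>\<^sub>E {S. S \<noteq> {} \<and> S \<subseteq> pverts (cycle_graph k)}"
      using k_pos by (auto simp: cycle_graph_def nat_less_iff)
    show "\<forall>(u, v)\<in>parcs G. \<forall>x\<in>?\<eta> u. \<forall>y\<in>?\<eta> v. (x, y) \<in> parcs (cycle_graph k)"
    proof clarify
      fix u v x y assume uv: "(u, v) \<in> parcs G" and xy: "x \<in> ?\<eta> u" "y \<in> ?\<eta> v"
      have "x \<in> (\<lambda>n. nat ((f u + 2 * n) mod int k)) ` {\<lfloor>d u\<rfloor>, \<lceil>d u\<rceil>}"
          "y \<in> (\<lambda>n. nat ((f v + 2 * n) mod int k)) ` {\<lfloor>d v\<rfloor>, \<lceil>d v\<rceil>}"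
        using xy arcs[OF uv] by (simp_all only: restrict_apply' simp_thms)
      then obtain a b where "a \<in> {\<lfloor>d u\<rfloor>, \<lceil>d u\<rceil>}" "b \<in> {\<lfloor>d v\<rfloor>, \<lceil>d v\<rceil>}"
          and "x = nat ((f u + 2 * a) mod int k)" "y = nat ((f v + 2 * b) mod int k)"
        by (elim imageE)
      then show "(x, y) \<in> parcs (cycle_graph k)"
        using adj[OF uv] by (simp only: parcs_cycle_graph[OF k_pos])
    qed
  qed
  have mem: "proj f d \<in> (\<Pi>\<^sub>E v\<in>pverts G. simplex_on (?\<eta> v))"
  proof (rule PiE_I)
    fix v assume "v \<in> pverts G"
    then show "proj f d v \<in> simplex_on (?\<eta> v)"
      unfolding proj_def using pos_in_simplex by (simp only: restrict_apply' simp_thms)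
  qed (simp add: proj_def)
  show ?thesis unfolding topspace_hom_complex by (rule UN_I[OF cell]) (rule mem)
qed

text \<open>A label \<open>x\<close> at a neighbour confines \<open>\<eta> v\<close> to
  \<open>x - 1\<close> and \<open>x + 1\<close>, which are corners of one segment of
  \<open>pos\<close>; the height is the weight of \<open>x + 1\<close>.\<close>

lemma edge_simplex:
  assumes \<eta>: "\<eta> \<in> hom_cells G (cycle_graph k)" and v: "v \<in> pverts G" and t: "t \<in> simplex_on (\<eta> v)"
  obtains a y where "0 \<le> y" "y < 1" "pos a y = t" "nat (a mod int k) \<in> \<eta> v"
    "0 < y \<Longrightarrow> nat ((a + 2) mod int k) \<in> \<eta> v"
proof -
  obtain u where vu: "(v, u) \<in> parcs G" using nbr[OF v] by blast
  then have u: "u \<in> pverts G" using arcs by blast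
  obtain x where x: "x \<in> \<eta> u" "x < k" using hom_cells_vert[OF \<eta> u] by (auto simp: cycle_graph_def)
  let ?x = "int x"
  let ?w1 = "nat ((?x - 1) mod int k)" and ?w2 = "nat ((?x + 1) mod int k)"
  have sub: "\<eta> v \<subseteq> {?w1, ?w2}"
  proof
    fix w assume w: "w \<in> \<eta> v"
    then have "w < k" using hom_cells_vert[OF \<eta> v] by (auto simp: cycle_graph_def)
    have "(w, x) \<in> parcs (cycle_graph k)" using hom_cells_arc[OF \<eta> vu w x(1)] .
    then have "(nat (int w mod int k), nat (int x mod int k)) \<in> parcs (cycle_graph k)"
      using \<open>w < k\<close> x(2) by simp
    then have "int k dvd ?x - int w - 1 \<or> int k dvd ?x - int w + 1"
      by (simp only: parcs_cycle_graph[OF k_pos])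
    then have "int k dvd ?x - 1 - int w \<or> int k dvd ?x + 1 - int w" by (simp add: algebra_simps)
    then have "(?x - 1) mod int k = int w mod int k \<or> (?x + 1) mod int k = int w mod int k"
      by (simp only: mod_eq_dvd_iff)
    then show "w \<in> {?w1, ?w2}" using \<open>w < k\<close> by auto
  qed
  have k0: "0 \<le> m mod int k" for m using k_pos by simp
  have ne: "?w1 \<noteq> ?w2"
  proof -
    have "(?x - 1) mod int k \<noteq> (?x + 1) mod int k"
      using k_dvd_small[of "-2"] by (auto simp: mod_eq_dvd_iff)
    then show ?thesis by (simp only: eq_nat_nat_iff[OF k0 k0] not_False_eq_True)
  qed
  have t': "0 \<le> t w" "w \<notin> \<eta> v \<Longrightarrow> t w = 0" "sum t (\<eta> v) = 1" for w
    using t by (auto simp: simplex_on_def)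
  have "sum t (\<eta> v) = sum t {?w1, ?w2}"
    using sub t'(2) by (intro sum.mono_neutral_left) auto
  then have sum: "t ?w1 + t ?w2 = 1" using t'(3) ne by simp
  have out: "t w = 0" if "w \<noteq> ?w1" "w \<noteq> ?w2" for w
    using sub that by (intro t'(2)) auto
  have eqw: "int w = m mod int k \<longleftrightarrow> w = nat (m mod int k)" for w m
    using k0[of m] by auto
  \<comment> \<open>Height 1 is excluded, so the corner \<open>x + 1\<close> is described by
    starting there with height 0.\<close>
  show thesis
  proof (cases "t ?w1 = 0")
    case True
    show thesis
    proof (rule that[of 0 "?x + 1"])
      show "pos (?x + 1) 0 = t"
      proof
        fix w
        have "pos (?x + 1) 0 w = of_bool (w = ?w2)" by (simp add: pos_def eqw)
        also have "\<dots> = t w"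
          using sum True out[of w] by (cases "w = ?w1"; cases "w = ?w2") (simp_all add: ne)
        finally show "pos (?x + 1) 0 w = t w" .
      qed
      show "?w2 \<in> \<eta> v" using t'(2)[of ?w2] sum True by force
    qed simp_all
  next
    case False
    have w12: "?x - 1 + 2 = ?x + 1" by simp
    have lt: "t ?w2 < 1" using sum False t'(1)[of ?w1] by linarith
    have fl: "\<lfloor>t ?w2\<rfloor> = 0" using lt t'(1)[of ?w2] by (simp add: floor_eq_iff)
    then have fr: "frac (t ?w2) = t ?w2" by (simp add: frac_def)
    show thesis
    proof (rule that[of "t ?w2" "?x - 1"])
      show "pos (?x - 1) (t ?w2) = t"
      proof
        fix w
        have "pos (?x - 1) (t ?w2) w = (1 - t ?w2) * of_bool (w = ?w1) + t ?w2 * of_bool (w = ?w2)"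
          unfolding pos_def fl fr eqw by (simp only: mult_zero_right add_0_right w12)
        also have "\<dots> = t w"
          using sum out[of w] ne by (cases "w = ?w1"; cases "w = ?w2") simp_all
        finally show "pos (?x - 1) (t ?w2) w = t w" .
      qed
      show "?w1 \<in> \<eta> v" using t'(2)[of ?w1] False by blast
      show "nat ((?x - 1 + 2) mod int k) \<in> \<eta> v" if "0 < t ?w2"
        unfolding w12 using t'(2)[of ?w2] that by force
    qed (use lt t'(1) in auto)
  qed
qed

text \<open>The starting labels belong to the cell and therefore form a homomorphism; relative to it
  the point has heights in the half-open unit interval, in a cube with corner
  \<open>0\<close>.\<close>

lemma hom_complex_cover:
  assumes "t \<in> topspace (hom_complex G (cycle_graph k))"
  shows "\<exists>f. hom f \<and> t \<in> piece f"
proof -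
  obtain \<eta> where \<eta>: "\<eta> \<in> hom_cells G (cycle_graph k)" and t: "t \<in> (\<Pi>\<^sub>E v\<in>pverts G. simplex_on (\<eta> v))"
    using assms unfolding topspace_hom_complex by blast
  have "\<exists>a y. 0 \<le> y \<and> y < 1 \<and> pos a y = t v \<and> nat (a mod int k) \<in> \<eta> v \<and>
      (0 < y \<longrightarrow> nat ((a + 2) mod int k) \<in> \<eta> v)" if v: "v \<in> pverts G" for v
    by (rule edge_simplex[OF \<eta> v PiE_mem[OF t v]]) blast
  then obtain f y where fy: "\<And>v. v \<in> pverts G \<Longrightarrow> 0 \<le> y v" "\<And>v. v \<in> pverts G \<Longrightarrow> y v < 1"
      "\<And>v. v \<in> pverts G \<Longrightarrow> pos (f v) (y v) = t v" "\<And>v. v \<in> pverts G \<Longrightarrow> nat (f v mod int k) \<in> \<eta> v"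
      "\<And>v. v \<in> pverts G \<Longrightarrow> 0 < y v \<Longrightarrow> nat ((f v + 2) mod int k) \<in> \<eta> v"
    by metis
  \<comment> \<open>Outside the graph the value of the root is used, as \<open>lift\<close>
    demands.\<close>
  define d where "d v = (if v \<in> pverts G then y v else y r)" for v
  have d01: "0 \<le> d v" "d v < 1" for v using fy(1,2) root by (auto simp: d_def)
  then have floor: "\<lfloor>d v\<rfloor> = 0" for v by (simp add: floor_eq_iff)
  have hom: "hom f"
    unfolding hom_def
  proof clarify
    fix u v assume uv: "(u, v) \<in> parcs G" and "\<not> int k dvd f v - f u + 1"
    moreover have "(nat (f u mod int k), nat (f v mod int k)) \<in> parcs (cycle_graph k)"
      using arcs[OF uv] by (intro hom_cells_arc[OF \<eta> uv] fy(4)) simp_all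
    ultimately show "int k dvd f v - f u - 1" by (simp add: parcs_cycle_graph[OF k_pos])
  qed
  have lift: "d \<in> lift f"
    unfolding lift_def
  proof (intro CollectI conjI)
    show "\<forall>(u, v)\<in>up f. \<lceil>d v\<rceil> \<le> \<lfloor>d u\<rfloor> \<and> \<lceil>d u\<rceil> \<le> \<lfloor>d v\<rfloor> + 1"
    proof (intro ballI, clarify)
      fix u v assume up: "(u, v) \<in> up f"
      then have uv: "(u, v) \<in> parcs G" by (simp add: up_def)
      then have V: "u \<in> pverts G" "v \<in> pverts G" using arcs by auto
      \<comment> \<open>Only the lower end of an up arc can move: \<open>f v + 2\<close> exceeds
        \<open>f u\<close> by 3, and adjacency would make \<open>k\<close> divide 2 or 4.\<close>
      have "\<not> 0 < y v"
      proof
        assume "0 < y v"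
        then have "(nat (f u mod int k), nat ((f v + 2) mod int k)) \<in> parcs (cycle_graph k)"
          using hom_cells_arc[OF \<eta> uv fy(4)[OF V(1)] fy(5)[OF V(2)]] by blast
        then have "int k dvd f v + 2 - f u - 1 \<or> int k dvd f v + 2 - f u + 1"
          by (simp only: parcs_cycle_graph[OF k_pos])
        moreover have "int k dvd f v - f u - 1" using up by (simp add: up_def)
        ultimately have "int k dvd (f v + 2 - f u - 1) - (f v - f u - 1) \<or> int k dvd (f v + 2 - f u + 1) - (f v - f u - 1)"
          using dvd_diff by blast
        then have "int k dvd 2 \<or> int k dvd 4" by simp
        then show False using k_dvd_small[of 2] k_dvd_4 by auto
      qed
      then have "d v = 0" using fy(1)[OF V(2)] V by (simp add: d_def)
      moreover have "\<lceil>d u\<rceil> \<le> 1" using d01(2)[of u] by (simp add: ceiling_le_iff)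
      ultimately show "\<lceil>d v\<rceil> \<le> \<lfloor>d u\<rfloor> \<and> \<lceil>d u\<rceil> \<le> \<lfloor>d v\<rfloor> + 1" using floor by simp
    qed
  qed (use root in \<open>auto simp: d_def\<close>)
  have "path_component (lift f) d (\<lambda>_. 0)"
  proof (rule lift_path_box[OF lift])
    show "0 \<le> real_of_int \<lceil>d v\<rceil>" for v
      using d01(1)[of v] le_of_int_ceiling[of "d v"] by linarith
  qed (simp_all add: floor)
  then have comp: "d \<in> component f"
    unfolding component_def by (simp add: path_component_sym)
  have "proj f d = t"
  proof
    fix v show "proj f d v = t v"
      using fy(3) PiE_arb[OF t] by (cases "v \<in> pverts G") (auto simp: proj_def d_def)
  qed
  then show ?thesis using hom comp unfolding piece_def by blast
qed

text \<open>The component may be unbounded, so compactness is gained by varying the base: after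
  rebasing at the floors, a point has heights in the unit cube. The piece is thus a finite union of
  projections of compact sets \<open>M g\<close>, over reduced labels \<open>g\<close> with the same
  piece.\<close>

lemma closedin_piece:
  assumes f: "hom f"
  shows "closedin amb (piece f)"
proof -
  define M where "M g = component g \<inter> PiE UNIV (\<lambda>_. {0..1})" for g
  let ?F = "{g. \<forall>v. (v \<in> pverts G \<longrightarrow> g v \<in> {0..<int k}) \<and> (v \<notin> pverts G \<longrightarrow> g v = 0)}"
  have fin: "finite ?F" using fin by (intro finite_set_of_finite_funs) auto
  have closed: "closedin amb (proj g ` M g)" for g
  proof -
    have "closed (PiE UNIV (\<lambda>_::'a. {0..1::real}))"
      using closedin_product_topology[of "\<lambda>_. euclideanreal" UNIV "\<lambda>_::'a. {0..1}"]
      by (simp add: euclidean_product_topology)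
    then have "closed (M g)" unfolding M_def by (intro closed_Int closed_component)
    then have "compact (M g)"
      by (rule component_bounded_compact[rotated, where f = g and a = 0 and b = 1]) (auto simp: M_def)
    then have "compactin (top_of_set (M g)) (M g)" by (simp add: compactin_subtopology)
    then have "compactin amb (proj g ` M g)" using continuous_map_proj by (rule image_compactin)
    then show ?thesis
      using compactin_imp_closedin[of amb] Hausdorff_amb[of UNIV] by simp
  qed
  have "piece f = (\<Union>g\<in>{g \<in> ?F. piece g = piece f}. proj g ` M g)"
  proof (intro subset_antisym subsetI)
    fix x assume "x \<in> piece f"
    then obtain d where d: "d \<in> component f" "x = proj f d" by (auto simp: piece_def)
    note e = component_floor[OF d(1)]
    let ?f = "\<lambda>v. f v + 2 * \<lfloor>d v\<rfloor>" and ?d = "\<lambda>v. frac (d v)"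
    let ?g = "\<lambda>v. if v \<in> pverts G then (f v + 2 * \<lfloor>d v\<rfloor>) mod int k else 0"
    have dvd: "int k dvd ?f v - ?g v" if "v \<in> pverts G" for v
      using that by (simp add: minus_mod_eq_mult_div)
    have sum: "?d v + of_int \<lfloor>d v\<rfloor> = d v" for v by (simp add: frac_def)
    have "?d \<in> component ?f"
      unfolding component_rebase[OF f e] sum by (rule d(1))
    then have "?d \<in> component ?g" using rep_cong(2)[of ?f ?g, OF dvd] by simp
    then have "?d \<in> M ?g" using frac_lt_1[THEN less_imp_le] by (auto simp: M_def)
    moreover have "x = proj ?g ?d"
    proof -
      have "pos (?f v) (?d v) = pos (f v) (d v)" for v
        unfolding pos_add_int[symmetric] sum ..
      then have "proj f d = proj ?f ?d" by (simp add: proj_def)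
      then show ?thesis using d(2) rep_cong(1)[of ?f ?g, OF dvd] by simp
    qed
    moreover have "piece ?g = piece f"
      using piece_cong[of ?f ?g, OF dvd] piece_rebase[OF f e] by simp
    moreover have "?g \<in> ?F" using k_pos by auto
    ultimately show "x \<in> (\<Union>g\<in>{g \<in> ?F. piece g = piece f}. proj g ` M g)"
      by (intro UN_I[of ?g] image_eqI[of _ _ ?d] CollectI conjI) simp_all
  next
    fix x assume "x \<in> (\<Union>g\<in>{g \<in> ?F. piece g = piece f}. proj g ` M g)"
    then obtain g where "piece g = piece f" "x \<in> proj g ` M g" by blast
    then show "x \<in> piece f" by (auto simp: M_def piece_def)
  qed
  also have "closedin amb \<dots>"
  proof (rule closedin_Union)
    show "finite ((\<lambda>g. proj g ` M g) ` {g \<in> ?F. piece g = piece f})"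
      using fin by simp
  qed (use closed in blast)
  finally show ?thesis .
qed

lemma points_circles:
  "\<exists>(I :: nat set) (X :: nat \<Rightarrow> complex topology).
     (\<forall>i \<in> I. X i = top_of_set {0} \<or> X i = top_of_set (sphere 0 1)) \<and>
     hom_complex G (cycle_graph k) homotopy_equivalent_space sum_topology X I"
proof (rule points_circles_of_pieces[OF finite_pieces])
  show "topspace (hom_complex G (cycle_graph k)) = \<Union> (piece ` Collect hom)"
  proof (intro subset_antisym subsetI)
    fix t assume "t \<in> topspace (hom_complex G (cycle_graph k))"
    then show "t \<in> \<Union> (piece ` Collect hom)" using hom_complex_cover by blast
  next
    fix t assume "t \<in> \<Union> (piece ` Collect hom)"
    then obtain f d where "hom f" "d \<in> component f" "t = proj f d" by (auto simp: piece_def)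
    then show "t \<in> topspace (hom_complex G (cycle_graph k))"
      using proj_in_hom_complex component_subset by blast
  qed
  show "disjoint (piece ` Collect hom)"
  proof (rule disjointI)
    fix A B assume "A \<in> piece ` Collect hom" "B \<in> piece ` Collect hom" "A \<noteq> B"
    then show "A \<inter> B = {}" using piece_eqI by blast
  qed
  fix A assume "A \<in> piece ` Collect hom"
  then obtain f where f: "hom f" "A = piece f" by blast
  show "closedin amb A" using closedin_piece f by simp
  show "\<exists>Y\<in>{top_of_set {0::complex}, top_of_set (sphere 0 1)}. subtopology amb A homotopy_equivalent_space Y"
    unfolding f(2) by (rule piece_homotopy_type[OF f(1)])
qed

end

theorem theorem1p1:
  fixes G :: "'a pair_pre_digraph" and k :: nat
  assumes "pair_graph G"
    and "Digraph_Component.connected (with_proj G)"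
    and "k \<ge> 3"
  shows "\<exists>(I :: nat set) (X :: nat \<Rightarrow> complex topology).
           (\<forall>i \<in> I. X i = top_of_set {0} \<or> X i = top_of_set (sphere 0 1)) \<and>
           hom_complex G (cycle_graph k) homotopy_equivalent_space sum_topology X I"
proof -
  interpret pair_graph G by fact
  have fin: "finite (pverts G)" by (rule pair_finite_verts)
  have arcs: "u \<in> pverts G \<and> v \<in> pverts G" if "(u, v) \<in> parcs G" for u v
    using arc_fst_in_verts[OF that] arc_snd_in_verts[OF that] by simp
  have sym: "(v, u) \<in> parcs G" if "(u, v) \<in> parcs G" for u v
    using pair_sym_arcs that by (auto simp: symmetric_def sym_def)
  have "strongly_connected (with_proj G)"
    using symmetric_connected_imp_strongly_connected pair_sym_arcs assms(2) by blast
  then have ne: "pverts G \<noteq> {}" and reach: "\<And>u v. u \<in> pverts G \<Longrightarrow> v \<in> pverts G \<Longrightarrow> (u, v) \<in> rtrancl_on (pverts G) (parcs G)"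
    by (auto simp: strongly_connected_def reachable_def)
  have conn: "P v" if "P r" "\<And>u v. (u, v) \<in> parcs G \<Longrightarrow> P u \<Longrightarrow> P v" "r \<in> pverts G" "v \<in> pverts G" for P r v
    using reach[OF that(3,4)] that(1,2) by (induction rule: rtrancl_on_induct) auto
  obtain r where r: "r \<in> pverts G" using ne by blast
  show ?thesis
  proof (cases "parcs G = {}")
    \<comment> \<open>A connected graph without arcs is a single vertex, and the complex is one
      simplex.\<close>
    case True
    show ?thesis
    proof (rule points_circles_of_pieces[where \<A> = "{\<Pi>\<^sub>E v\<in>pverts G. simplex_on {..<k}}"])
      show "topspace (hom_complex G (cycle_graph k)) = \<Union> {\<Pi>\<^sub>E v\<in>pverts G. simplex_on {..<k}}"
        using hom_complex_no_arcs[OF True, of k] assms(3) by simp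
      have "{..<k} \<noteq> {}" using assms(3) by (auto simp: lessThan_empty_iff)
      then show "\<exists>Y\<in>{top_of_set {0::complex}, top_of_set (sphere 0 1)}.
          subtopology (product_topology (\<lambda>_. euclidean) (pverts G)) A homotopy_equivalent_space Y"
        if "A \<in> {\<Pi>\<^sub>E v\<in>pverts G. simplex_on {..<k}}" for A
        using that product_of_simplices_point[of "pverts G" "\<lambda>_. {..<k}" "0::complex"] by simp
    qed (auto intro: closedin_product_of_simplices)
  next
    case False
    \<comment> \<open>By \<open>conn\<close> a vertex without outgoing arcs would be the only
      vertex, and then there would be no arcs at all.\<close>
    have nbr: "\<exists>u. (v, u) \<in> parcs G" if v: "v \<in> pverts G" for v
    proof (rule ccontr)
      assume none: "\<nexists>u. (v, u) \<in> parcs G"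
      then have "w = v" if "w \<in> pverts G" for w
        using conn[of "\<lambda>x. x = v" v w] v that by blast
      with False none arcs show False by fast
    qed
    show ?thesis
    proof (cases "k = 4")
      case True
      then show ?thesis using points_circles_square[OF fin arcs] nbr sym by blast
    next
      case False
      interpret cycle_homs G r k
        by unfold_locales (use fin r arcs sym conn nbr False assms(3) in blast)+
      show ?thesis by (rule points_circles)
    qed
  qed
qed

end
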